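(* Given any $a\in\mathbb{R}$, let $t_1=t_1(a)$ and $t_2=t_2(a)$ be the positive solutions of $t_1=\coth(t_1+a)$ and $t_2=\coth(t_2-a)$, and let $\alpha=t_1/t_2$. Then: (i) $\alpha$ is a decreasing function of $a$ with range all of $\mathbb{R}_+=(0,\infty)$; (ii) $T(\alpha)=t_1+t_2$, and the maximum value of $\sigma_1 L$ over rotationally symmetric metrics on the annulus with ratio of boundary lengths $\alpha$ fixed is $2\pi(t_1^{-1}+t_2^{-1})$; (iii) the maximum of $\sigma_1 L$ over all rotationally symmetric metrics on the annulus occurs uniquely when $a=0$, hence $\alpha=1$, and it is equal to $4\pi/t_1$ where $t_1=\coth t_1$, $t_1>0$. The corresponding optimal value of $T$ is $T(1)=2t_1$. The numerical value of $t_1$ is approximately $1.2$.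
   Context: A rotationally symmetric metric on the annulus is a metric isometric to $f^2(t)(dt^2+d\theta^2)$ on $\Sigma=[0,T]\times S^1$ ($S^1=\mathbb{R}/2\pi\mathbb{Z}$), for some $T>0$ and some positive function $f$ on $[0,T]$. Its ratio of boundary lengths is $\alpha=f(0)/f(T)$, and $L=L(\partial\Sigma)=2\pi(f(0)+f(T))$. $\sigma_1$ is the first nonzero eigenvalue of the Dirichlet-to-Neumann map $u\mapsto\partial\hat u/\partial\nu$ on $\partial\Sigma$, where $\hat u$ is the harmonic extension of $u$ and $\nu$ is the outward unit conormal. Definition of $T(\alpha)$: set $$\lambda_0^{(2)}=\frac{f(0)+f(T)}{f(0)f(T)T},\qquad \lambda_1^{(1)}=\tfrac12\Big([f(0)^{-1}+f(T)^{-1}]\coth T-\sqrt{D}\Big),$$ $$D=[f(0)^{-1}+f(T)^{-1}]^2\coth^2 T-4f(0)^{-1}f(T)^{-1}.$$ These are Dirichlet-to-Neumann eigenvalues, with eigenfunctions respectively affine in $t$ (independent of $\theta$) and of the form $(A\sinh t+B\cosh t)\cos\theta$, $(A\sinh t+B\cosh t)\sin\theta$, and $\sigma_1=\min\{\lambda_0^{(2)},\lambda_1^{(1)}\}$. The quotient $\lambda_1^{(1)}/\lambda_0^{(2)}$ depends only on $T$ and $\alpha$. For fixed $\alpha>0$, $T(\alpha)$ denotes the unique positive number such that $\sigma_1=\lambda_1^{(1)}$ for $T\le T(\alpha)$ and $\sigma_1=\lambda_0^{(2)}$ for $T\ge T(\alpha)$. The uniqueness in (iii) is in terms of the parameters $\alpha$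 and $T$: $\sigma_1L$ depends on a rotationally symmetric metric only through $\alpha$ and $T$, and $\alpha$ and $\alpha^{-1}$ play symmetric roles. *)

theory Defs
  imports "HOL-Analysis.Analysis"
begin

definition coth :: "real \<Rightarrow> real" where
  "coth x = cosh x / sinh x"

text \<open>
  The cylinder \<open>[0,T] \<times> S\<^sup>1\<close> is represented by the strip \<open>[0,T] \<times> \<real>\<close>; functions on the
  cylinder are functions of \<open>(t,\<theta>)\<close> that are \<open>2\<pi>\<close>-periodic in \<open>\<theta>\<close>. Values outside the
  strip are irrelevant. Smooth always means smooth up to the boundary, so \<open>t\<close>-derivatives at
  \<open>t = 0\<close> and \<open>t = T\<close> are one-sided.
\<close>

definition strip :: "real \<Rightarrow> (real \<times> real) set" where
  "strip T = {0..T} \<times> UNIV"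

definition strip_boundary :: "real \<Rightarrow> (real \<times> real) set" where
  "strip_boundary T = {0, T} \<times> UNIV"

definition smooth_on_interval :: "real \<Rightarrow> (real \<Rightarrow> real) \<Rightarrow> bool" where
  "smooth_on_interval T f \<longleftrightarrow>
     (\<exists>F :: nat \<Rightarrow> real \<Rightarrow> real.
        (\<forall>t\<in>{0..T}. F 0 t = f t) \<and>
        (\<forall>n. \<forall>t\<in>{0..T}. (F n has_real_derivative F (Suc n) t) (at t within {0..T})))"

text \<open>The metric \<open>f\<^sup>2(t)(dt\<^sup>2 + d\<theta>\<^sup>2)\<close> on \<open>[0,T] \<times> S\<^sup>1\<close> is given by the pair \<open>T\<close>, \<open>f\<close>.\<close>

definition rot_sym_metric :: "real \<Rightarrow> (real \<Rightarrow> real) \<Rightarrow> bool" where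
  "rot_sym_metric T f \<longleftrightarrow> T > 0 \<and> (\<forall>t\<in>{0..T}. f t > 0) \<and> smooth_on_interval T f"

definition boundary_ratio :: "real \<Rightarrow> (real \<Rightarrow> real) \<Rightarrow> real" where
  "boundary_ratio T f = f 0 / f T"

definition boundary_length :: "real \<Rightarrow> (real \<Rightarrow> real) \<Rightarrow> real" where
  "boundary_length T f = 2 * pi * (f 0 + f T)"

definition partial_t :: "real \<Rightarrow> (real \<times> real \<Rightarrow> real) \<Rightarrow> real \<times> real \<Rightarrow> real" where
  "partial_t T u = (\<lambda>(t, \<theta>). vector_derivative (\<lambda>s. u (s, \<theta>)) (at t within {0..T}))"

definition partial_theta :: "(real \<times> real \<Rightarrow> real) \<Rightarrow> real \<times> real \<Rightarrow> real" where
  "partial_theta u = (\<lambda>(t, \<theta>). vector_derivative (\<lambda>s. u (t, s)) (at \<theta>))"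

text \<open>
  Smooth functions on the cylinder: periodic, with continuous partial derivatives
  \<open>D i j = \<partial>\<^sub>t\<^sup>i \<partial>\<^sub>\<theta>\<^sup>j u\<close> of all orders on the closed strip.
\<close>

definition smooth_on_cylinder :: "real \<Rightarrow> (real \<times> real \<Rightarrow> real) \<Rightarrow> bool" where
  "smooth_on_cylinder T u \<longleftrightarrow>
     (\<forall>t\<in>{0..T}. \<forall>\<theta>. u (t, \<theta> + 2 * pi) = u (t, \<theta>)) \<and>
     (\<exists>D :: nat \<Rightarrow> nat \<Rightarrow> real \<times> real \<Rightarrow> real.
        (\<forall>p\<in>strip T. D 0 0 p = u p) \<and>
        (\<forall>i j. continuous_on (strip T) (D i j)) \<and>
        (\<forall>i j. \<forall>t\<in>{0..T}. \<forall>\<theta>.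
           ((\<lambda>s. D i j (s, \<theta>)) has_real_derivative D (Suc i) j (t, \<theta>)) (at t within {0..T}) \<and>
           ((\<lambda>s. D i j (t, s)) has_real_derivative D i (Suc j) (t, \<theta>)) (at \<theta>)))"

text \<open>The Laplace-Beltrami operator of \<open>f\<^sup>2(dt\<^sup>2 + d\<theta>\<^sup>2)\<close>.\<close>

definition laplacian :: "real \<Rightarrow> (real \<Rightarrow> real) \<Rightarrow> (real \<times> real \<Rightarrow> real) \<Rightarrow> real \<times> real \<Rightarrow> real" where
  "laplacian T f u p =
     (partial_t T (partial_t T u) p + partial_theta (partial_theta u) p) / (f (fst p))\<^sup>2"

text \<open>
  The outward unit conormal is \<open>-f(0)\<^sup>-\<^sup>1\<partial>\<^sub>t\<close> on the component \<open>t = 0\<close> and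
  \<open>f(T)\<^sup>-\<^sup>1\<partial>\<^sub>t\<close> on the component \<open>t = T\<close>.
\<close>

definition conormal_derivative ::
  "real \<Rightarrow> (real \<Rightarrow> real) \<Rightarrow> (real \<times> real \<Rightarrow> real) \<Rightarrow> real \<times> real \<Rightarrow> real" where
  "conormal_derivative T f u p =
     (if fst p = 0 then - partial_t T u p / f 0 else partial_t T u p / f T)"

text \<open>Boundary functions are functions of \<open>(t,\<theta>)\<close> of which only the values at \<open>t \<in> {0,T}\<close> matter.\<close>

definition harmonic_extension ::
  "real \<Rightarrow> (real \<Rightarrow> real) \<Rightarrow> (real \<times> real \<Rightarrow> real) \<Rightarrow> (real \<times> real \<Rightarrow> real) \<Rightarrow> bool" where
  "harmonic_extension T f u v \<longleftrightarrow>
     smooth_on_cylinder T v \<and>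
     (\<forall>p\<in>strip T. laplacian T f v p = 0) \<and>
     (\<forall>p\<in>strip_boundary T. v p = u p)"

text \<open>The graph of the Dirichlet-to-Neumann map: \<open>w\<close> is its value at \<open>u\<close>.\<close>

definition dirichlet_to_neumann ::
  "real \<Rightarrow> (real \<Rightarrow> real) \<Rightarrow> (real \<times> real \<Rightarrow> real) \<Rightarrow> (real \<times> real \<Rightarrow> real) \<Rightarrow> bool" where
  "dirichlet_to_neumann T f u w \<longleftrightarrow>
     (\<exists>v. harmonic_extension T f u v \<and>
          (\<forall>p\<in>strip_boundary T. w p = conormal_derivative T f v p))"

definition dtn_eigenvalue :: "real \<Rightarrow> (real \<Rightarrow> real) \<Rightarrow> real \<Rightarrow> bool" where
  "dtn_eigenvalue T f \<sigma> \<longleftrightarrow>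
     (\<exists>u. (\<exists>p\<in>strip_boundary T. u p \<noteq> 0) \<and> dirichlet_to_neumann T f u (\<lambda>p. \<sigma> * u p))"

definition sigma1 :: "real \<Rightarrow> (real \<Rightarrow> real) \<Rightarrow> real" where
  "sigma1 T f = (LEAST \<sigma>. dtn_eigenvalue T f \<sigma> \<and> \<sigma> \<noteq> 0)"

definition sigma1_L :: "real \<Rightarrow> (real \<Rightarrow> real) \<Rightarrow> real" where
  "sigma1_L T f = sigma1 T f * boundary_length T f"

definition lambda02 :: "real \<Rightarrow> (real \<Rightarrow> real) \<Rightarrow> real" where
  "lambda02 T f = (f 0 + f T) / (f 0 * f T * T)"

definition lambda11 :: "real \<Rightarrow> (real \<Rightarrow> real) \<Rightarrow> real" where
  "lambda11 T f =
     (let s = inverse (f 0) + inverse (f T);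
          D = s\<^sup>2 * (coth T)\<^sup>2 - 4 * inverse (f 0) * inverse (f T)
      in (s * coth T - sqrt D) / 2)"

definition is_transition :: "real \<Rightarrow> real \<Rightarrow> bool" where
  "is_transition \<alpha> T0 \<longleftrightarrow>
     T0 > 0 \<and>
     (\<forall>T f. rot_sym_metric T f \<and> boundary_ratio T f = \<alpha> \<longrightarrow>
        (T \<le> T0 \<longrightarrow> sigma1 T f = lambda11 T f) \<and>
        (T \<ge> T0 \<longrightarrow> sigma1 T f = lambda02 T f))"

definition T_of :: "real \<Rightarrow> real" where
  "T_of \<alpha> = (THE T0. is_transition \<alpha> T0)"

definition t1 :: "real \<Rightarrow> real" where
  "t1 a = (THE t. t > 0 \<and> t = coth (t + a))"

definition t2 :: "real \<Rightarrow> real" where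
  "t2 a = (THE t. t > 0 \<and> t = coth (t - a))"

definition alpha :: "real \<Rightarrow> real" where
  "alpha a = t1 a / t2 a"

definition is_maximum :: "real set \<Rightarrow> real \<Rightarrow> bool" where
  "is_maximum S m \<longleftrightarrow> m \<in> S \<and> (\<forall>x\<in>S. x \<le> m)"

end

theory Submission
  imports Defs
begin

text \<open>
  On the cylinder a harmonic function decomposes into Fourier modes \<open>c(t) cos (k \<theta> - \<phi>)\<close> with
  \<open>c'' = k\<^sup>2 c\<close>, and the Dirichlet-to-Neumann eigenvalue condition is imposed on every mode separately,
  because \<open>f\<close> is constant on each boundary circle. The mode \<open>k = 0\<close> contributes the eigenvalues \<open>0\<close>
  and \<open>lambda02\<close>. For \<open>k \<noteq> 0\<close> the eigenvalues are bounded below by an energy that increases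
  with \<open>\<bar>k\<bar>\<close>, so the smallest one is \<open>lambda11\<close>, attained for \<open>\<bar>k\<bar> = 1\<close>. Completeness of the
  trigonometric system (\<open>trig_orthogonal_imp_zero\<close>) guarantees that each eigenfunction has a nonzero
  mode, and \<open>sigma1\<close> is the minimum of \<open>lambda02\<close> and \<open>lambda11\<close> (\<open>sigma1_eq_min\<close>).

  The minimum is compared with a fixed number. For the boundary ratio \<open>alpha a = t1 a / t2 a\<close> put
  \<open>l = 1 / (t2 a * f 0) = 1 / (t1 a * f T)\<close>. Then \<open>lambda02 = l (t1 a + t2 a) / T\<close> passes below \<open>l\<close>
  at \<open>T = t1 a + t2 a\<close>. The defining equations of \<open>t1\<close> and \<open>t2\<close> say that \<open>l * f T\<close> and \<open>l * f 0\<close> are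
  the hyperbolic tangents of \<open>t1 a + a\<close> and \<open>t2 a - a\<close>, and the addition formula shows that
  \<open>lambda11\<close> passes above \<open>l\<close> at \<open>T = (t1 a + a) + (t2 a - a)\<close>, the same value
  (\<open>eigenvalue_comparison\<close>). This gives the transition value and also the maximum for a fixed ratio,
  as \<open>sigma1 \<le> l\<close> with equality exactly at the transition, and \<open>l\<close> times the boundary length is
  \<open>2\<pi> (1 / t1 a + 1 / t2 a)\<close>.

  Finally, \<open>s = 1 / t1 a\<close> satisfies \<open>artanh s - 1 / s = a\<close>. The left-hand side has derivative
  \<open>1 / (s\<^sup>2 - s\<^sup>4)\<close>, and its zero \<open>s\<^sub>0 = 1 / t1 0\<close> lies beyond the minimum \<open>s\<^sup>2 = 1/2\<close> of this
  derivative. Hence the function rises faster to the right of \<open>s\<^sub>0\<close> than to the left, and the two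
  solutions for \<open>a\<close> and \<open>-a\<close> have a sum smaller than \<open>2 s\<^sub>0\<close> unless \<open>a = 0\<close>
  (\<open>inverse_t1_add_inverse_t2_less\<close>).
\<close>

section \<open>The transcendental equation and the ratio of boundary lengths\<close>

lemma coth_gt_1: "x > 0 \<Longrightarrow> coth x > 1"
  using sinh_less_cosh_real[of x] by (simp add: coth_def divide_simps)

lemma coth_nonpos: "x \<le> 0 \<Longrightarrow> coth x \<le> 0"
  by (simp add: coth_def divide_nonneg_nonpos)

lemma coth_strict_decreasing:
  assumes "0 < x" "x < y"
  shows "coth y < coth x"
proof -
  have "coth x - coth y = sinh (y - x) / (sinh x * sinh y)"
    using assms by (simp add: coth_def sinh_diff field_simps)
  also have "\<dots> > 0"
    using assms by simp
  finally show ?thesis by simp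
qed

lemma coth_decreasing:
  assumes "0 < x" "x \<le> y"
  shows "coth y \<le> coth x"
  using assms coth_strict_decreasing[of x y] by (cases "x = y") auto

lemma inverse_coth: "inverse (coth x) = tanh x"
  by (simp add: coth_def tanh_def)

text \<open>
  The bound \<open>tanh x \<le> x\<close> in a form that makes \<open>coth\<close> large near \<open>0\<close>. It holds since
  \<open>x cosh x - sinh x\<close> vanishes at \<open>0\<close> and has derivative \<open>x sinh x\<close>.
\<close>
lemma inverse_le_coth:
  assumes "x > 0"
  shows "1 / x \<le> coth x"
proof -
  have "0 * cosh 0 - sinh 0 \<le> x * cosh x - sinh x"
  proof (rule DERIV_nonneg_imp_nondecreasing[of 0 x])
    show "\<exists>y. ((\<lambda>t. t * cosh t - sinh t) has_real_derivative y) (at t) \<and> 0 \<le> y"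
      if "0 \<le> t" "t \<le> x" for t
      by (rule exI[of _ "t * sinh t"]) (use that in \<open>auto intro!: derivative_eq_intros\<close>)
  qed (use assms in auto)
  then show ?thesis
    using assms by (simp add: coth_def field_simps)
qed

text \<open>
  In terms of \<open>x = t + a\<close> the equation reads \<open>x - coth x = a\<close>, and \<open>x - coth x\<close> is increasing
  from \<open>-\<infinity>\<close> to \<open>\<infinity>\<close> on the positive half-line. A solution with \<open>t > 0\<close> has \<open>x > 0\<close>, as \<open>coth\<close> is not
  positive elsewhere; this includes \<open>coth 0 = 0\<close>, which comes from the convention \<open>1 / 0 = 0\<close>.
\<close>
lemma ex1_fixpoint_coth: "\<exists>!t. t > 0 \<and> t = coth (t + a)"
proof (rule ex_ex1I)
  \<comment> \<open>At \<open>l \<le> 1\<close> the bound \<open>coth l \<ge> 1 / l\<close> gives \<open>l - coth l \<le> - \<bar>a\<bar>\<close>; at \<open>r > 1\<close> the bound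
    \<open>coth r < coth 1\<close> gives \<open>r - coth r \<ge> \<bar>a\<bar>\<close>.\<close>
  define l where "l = 1 / (\<bar>a\<bar> + 1)"
  define r where "r = \<bar>a\<bar> + coth 1 + 1"
  have l: "0 < l" "l \<le> 1"
    by (simp_all add: l_def)
  have r: "1 < r"
    using coth_gt_1[of 1] by (simp add: r_def)
  have "l - coth l \<le> a"
  proof -
    have "1 / l = \<bar>a\<bar> + 1"
      by (simp add: l_def)
    then show ?thesis
      using inverse_le_coth[OF l(1)] l by linarith
  qed
  moreover have "a \<le> r - coth r"
    using coth_strict_decreasing[of 1 r] r by (simp add: r_def)
  moreover have "continuous_on {l..r} (\<lambda>x. x - coth x)"
    unfolding coth_def using l by (auto intro!: continuous_intros)
  ultimately obtain x where x: "l \<le> x" "x \<le> r" "x - coth x = a"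
    using IVT'[of "\<lambda>x. x - coth x" l a r] l r by auto
  then have "coth x > 1"
    using l by (intro coth_gt_1) auto
  with x have "coth x > 0 \<and> coth x = coth (coth x + a)"
    by (smt (verit))
  then show "\<exists>t. t > 0 \<and> t = coth (t + a)"
    by blast
next
  fix s t
  assume st: "s > 0 \<and> s = coth (s + a)" "t > 0 \<and> t = coth (t + a)"
  then have "s + a > 0" "t + a > 0"
    using coth_nonpos[of "s + a"] coth_nonpos[of "t + a"] by (smt (verit))+
  then show "s = t"
    using st coth_strict_decreasing[of "s + a" "t + a"] coth_strict_decreasing[of "t + a" "s + a"]
    by (smt (verit))
qed

lemma
  shows t1_pos: "t1 a > 0" and t1_eq: "t1 a = coth (t1 a + a)"
  using theI'[OF ex1_fixpoint_coth[of a]] unfolding t1_def by auto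

text \<open>
  The two defining equations are exchanged by \<open>a \<mapsto> -a\<close>. Everything about \<open>t2\<close> is read off
  from \<open>t1\<close> in this way.
\<close>
lemma t2_eq_t1: "t2 a = t1 (- a)"
  by (simp add: t1_def t2_def)

lemma t2_pos: "t2 a > 0"
  using t1_pos by (simp add: t2_eq_t1)

lemma t1_add_pos: "t1 a + a > 0"
  using t1_pos[of a] t1_eq[of a] coth_nonpos[of "t1 a + a"] by (smt (verit))

lemma t2_diff_pos: "t2 a - a > 0"
  using t1_add_pos[of "- a"] by (simp add: t2_eq_t1)

lemma t1_gt_1: "t1 a > 1"
  using coth_gt_1[OF t1_add_pos[of a]] t1_eq[of a] by simp

text \<open>
  The reciprocals are hyperbolic tangents of two numbers whose sum is \<open>t1 a + t2 a\<close>. The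
  addition formula for \<open>tanh\<close> will turn this into the relation between \<open>lambda11\<close> and the
  conformal length of the cylinder.
\<close>
lemma inverse_t1: "inverse (t1 a) = tanh (t1 a + a)"
  using t1_eq[of a] inverse_coth by metis

lemma inverse_t2: "inverse (t2 a) = tanh (t2 a - a)"
  using inverse_t1[of "- a"] by (simp add: t2_eq_t1)

lemma t1_strict_decreasing:
  assumes "a < b"
  shows "t1 b < t1 a"
proof (rule ccontr)
  assume "\<not> t1 b < t1 a"
  then have "coth (t1 b + b) < coth (t1 a + a)"
    using assms t1_add_pos[of a] by (intro coth_strict_decreasing) auto
  then show False
    using \<open>\<not> t1 b < t1 a\<close> t1_eq[of a] t1_eq[of b] by simp
qed

lemma t1_add_strict_increasing:
  assumes "a < b"
  shows "t1 a + a < t1 b + b"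
proof (rule ccontr)
  assume *: "\<not> t1 a + a < t1 b + b"
  then have "coth (t1 a + a) \<le> coth (t1 b + b)"
    using t1_add_pos[of b] coth_strict_decreasing[of "t1 b + b" "t1 a + a"] by force
  then show False
    using assms t1_strict_decreasing t1_eq by (metis linorder_not_less)
qed

text \<open>
  As \<open>t1 a\<close> decreases while \<open>t1 a + a\<close> increases, \<open>t1\<close> is 1-Lipschitz.
\<close>
lemma continuous_on_t1: "continuous_on UNIV t1"
proof -
  have "\<bar>t1 a - t1 b\<bar> \<le> \<bar>a - b\<bar>" for a b
    using t1_strict_decreasing[of a b] t1_add_strict_increasing[of a b]
      t1_strict_decreasing[of b a] t1_add_strict_increasing[of b a]
    by (cases a b rule: linorder_cases) auto
  then show ?thesis
    unfolding continuous_on_iff dist_real_def by (metis le_less_trans abs_minus_commute)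
qed

lemma alpha_pos: "alpha a > 0"
  by (simp add: alpha_def t1_pos t2_pos)

lemma alpha_0: "alpha 0 = 1"
  using t1_pos[of 0] by (simp add: alpha_def t2_eq_t1)

lemma alpha_uminus: "alpha (- a) = inverse (alpha a)"
  by (simp add: alpha_def t2_eq_t1)

lemma alpha_strict_decreasing:
  assumes "a < b"
  shows "alpha b < alpha a"
  unfolding alpha_def t2_eq_t1
  using assms t1_strict_decreasing[of a b] t1_strict_decreasing[of "- b" "- a"]
  by (intro frac_less) (auto simp: t1_pos less_imp_le)

lemma alpha_strict_antimono: "strict_antimono_on UNIV alpha"
  by (auto intro!: monotone_onI alpha_strict_decreasing)

lemma alpha_eq_iff: "alpha a = alpha b \<longleftrightarrow> a = b"
  using alpha_strict_decreasing[of a b] alpha_strict_decreasing[of b a]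
  by (cases a b rule: linorder_cases) auto

text \<open>
  For \<open>a > 0\<close> the numerator satisfies \<open>t1 a < t1 0\<close> and the denominator \<open>t2 a > a\<close>.
\<close>
lemma alpha_small:
  assumes "y > 0"
  shows "\<exists>a>0. alpha a < y"
proof (intro exI conjI)
  define a where "a = t1 0 / y"
  show a: "a > 0"
    using assms t1_pos by (simp add: a_def)
  have "alpha a < t1 0 / a"
    unfolding alpha_def using a t1_strict_decreasing[of 0 a] t2_diff_pos[of a] t1_pos
    by (intro frac_less) (auto simp: less_imp_le)
  also have "\<dots> = y"
    using assms t1_pos[of 0] by (simp add: a_def)
  finally show "alpha a < y" .
qed

text \<open>
  Small values come from the preceding bound, large ones from \<open>alpha (-a) = 1 / alpha a\<close>, and
  continuity fills in the rest. The intermediate value theorem is applied to the increasing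
  function \<open>- alpha\<close>.
\<close>
lemma range_alpha: "range alpha = {0<..}"
proof (intro equalityI subsetI)
  fix y :: real
  assume "y \<in> {0<..}"
  then have y: "y > 0" by simp
  obtain a where a: "a > 0" "alpha a < y"
    using alpha_small[OF y] by blast
  obtain b where b: "b > 0" "alpha b < inverse y"
    using alpha_small[of "inverse y"] y by auto
  have "y < alpha (- b)"
    using b y alpha_pos[of b] by (simp add: alpha_uminus field_simps)
  moreover have "continuous_on {- b..a} (\<lambda>x. - alpha x)"
    unfolding alpha_def t2_eq_t1
    by (intro continuous_intros continuous_on_compose2[OF continuous_on_t1]) (auto simp: t1_pos less_imp_neq[OF t1_pos, symmetric])
  ultimately show "y \<in> range alpha"
    using IVT'[of "\<lambda>x. - alpha x" "- b" "- y" a] a b by auto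
qed (auto simp: alpha_pos)

text \<open>
  By monotonicity it suffices to compare \<open>coth x\<close> with \<open>x\<close> at the two end points. Writing
  \<open>coth x = 1 + 2 / (exp (2 x) - 1)\<close>, it is enough that \<open>exp 2.3 < 14\<close> and \<open>exp 2.5 > 9\<close>; squaring
  \<open>exp 2.5\<close> reduces both to crude bounds for \<open>e\<^sup>5\<close>. The upper bound on \<open>t1 0\<close> is also used
  below, as it ensures \<open>t1 0 < sqrt 2\<close>.
\<close>
lemma
  shows t1_0_gt: "t1 0 > 1.15" and t1_0_less: "t1 0 < 1.25"
proof -
  have coth_exp: "coth x = 1 + 2 / (exp (2 * x) - 1)" if "x > 0" for x
  proof -
    have "exp (2 * x) = exp x * exp x"
      by (simp flip: exp_add)
    moreover have "(E + inverse E) / 2 / ((E - inverse E) / 2) = 1 + 2 / (E * E - 1)"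
      if "E > 1" for E :: real
    proof -
      have "E * E > 1"
        using that by (simp add: less_1_mult)
      then show ?thesis
        using that by (simp add: field_simps)
    qed
    ultimately show ?thesis
      using that unfolding coth_def cosh_field_def sinh_field_def exp_minus by simp
  qed
  have e5: "exp (5 / 2) ^ 2 = exp (1 :: real) ^ 5"
    by (simp flip: exp_of_nat_mult)
  have "exp (1 :: real) ^ 5 \<le> (272 / 100) ^ 5"
    using e_less_272 by (intro power_mono) auto
  also have "(272 / 100 :: real) ^ 5 < 14 ^ 2"
    by (simp add: power_divide)
  finally have "exp (5 / 2 :: real) ^ 2 < 14 ^ 2"
    unfolding e5 .
  then have "exp (5 / 2 :: real) < 14"
    using power_less_imp_less_base[of "exp (5 / 2 :: real)" 2 14] by simp
  moreover have "exp (23 / 10 :: real) < exp (5 / 2)"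
    by simp
  ultimately have u: "exp (23 / 10 :: real) < 14"
    by linarith
  have "(5 / 2) ^ 5 \<le> exp (1 :: real) ^ 5"
    using exp_lower_Taylor_quadratic[of 1] by (intro power_mono) auto
  moreover have "(9 :: real) ^ 2 < (5 / 2) ^ 5"
    by (simp add: power_divide)
  ultimately have "9 ^ 2 < exp (5 / 2 :: real) ^ 2"
    unfolding e5 by linarith
  then have l: "exp (5 / 2 :: real) > 9"
    using power_less_imp_less_base[of 9 2 "exp (5 / 2 :: real)"] by simp
  have "exp (23 / 10 :: real) > 1" by simp
  then have "2 / (14 - 1) < 2 / (exp (23 / 10 :: real) - 1)"
    using u by (intro divide_strict_left_mono mult_pos_pos) linarith+
  then have "coth 1.15 > 1.15"
    using coth_exp[of "1.15"] by simp
  show "t1 0 > 1.15"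
  proof (rule ccontr)
    assume "\<not> t1 0 > 1.15"
    then have "coth 1.15 \<le> coth (t1 0)"
      using t1_pos[of 0] by (intro coth_decreasing) auto
    with \<open>coth 1.15 > 1.15\<close> \<open>\<not> t1 0 > 1.15\<close> t1_eq[of 0] show False
      by simp
  qed
  have "2 / (exp (5 / 2 :: real) - 1) < 2 / (9 - 1)"
    using l by (intro divide_strict_left_mono mult_pos_pos) linarith+
  then have "coth 1.25 < 1.25"
    using coth_exp[of "1.25"] by simp
  show "t1 0 < 1.25"
  proof (rule ccontr)
    assume "\<not> t1 0 < 1.25"
    then have "coth (t1 0) \<le> coth 1.25"
      by (intro coth_decreasing) auto
    with \<open>coth 1.25 < 1.25\<close> \<open>\<not> t1 0 < 1.25\<close> t1_eq[of 0] show False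
      by simp
  qed
qed

section \<open>Maximality of the sum of reciprocals at the symmetric parameter\<close>

text \<open>
  Solving \<open>t = coth (t + a)\<close> for \<open>a\<close> gives this expression in \<open>s = 1 / t\<close>.
\<close>
definition a_of :: "real \<Rightarrow> real" where
  "a_of s = artanh s - 1 / s"

text \<open>
  The derivative depends on \<open>s\<^sup>2\<close> only, through \<open>z - z\<^sup>2\<close>, which is symmetric about \<open>z = 1/2\<close>.
\<close>
lemma a_of_deriv:
  assumes "0 < s" "s < 1"
  shows "(a_of has_real_derivative 1 / (s\<^sup>2 - (s\<^sup>2)\<^sup>2)) (at s)"
proof -
  have "s\<^sup>2 < 1"
    using assms by (simp add: power_less_one_iff abs_square_less_1)
  then have "s\<^sup>2 - (s\<^sup>2)\<^sup>2 \<noteq> 0" "1 - s\<^sup>2 \<noteq> 0"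
    using assms by (auto simp: power2_eq_square)
  then show ?thesis
    unfolding a_of_def[abs_def] using assms
    by (auto intro!: derivative_eq_intros simp: field_simps power2_eq_square)
qed

lemma a_of_deriv_pos:
  fixes s :: real
  assumes "0 < s" "s < 1"
  shows "s\<^sup>2 - (s\<^sup>2)\<^sup>2 > 0"
proof -
  have "s\<^sup>2 < 1"
    using assms by (simp add: power_less_one_iff abs_square_less_1)
  then show ?thesis
    using assms by (simp add: power2_eq_square)
qed

lemma a_of_strict_increasing:
  assumes "0 < s" "s < r" "r < 1"
  shows "a_of s < a_of r"
  using assms(2)
proof (rule DERIV_pos_imp_increasing)
  show "\<exists>y. (a_of has_real_derivative y) (at x) \<and> y > 0" if "s \<le> x" "x \<le> r" for x
    using that assms a_of_deriv[of x] a_of_deriv_pos[of x] by fastforce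
qed

lemma a_of_inverse_t1: "a_of (inverse (t1 a)) = a"
  unfolding a_of_def by (subst inverse_t1) (simp add: artanh_tanh_real divide_inverse)

text \<open>
  The derivative in \<open>d\<close> of the sum is a difference of values of \<open>1 / (z - z\<^sup>2)\<close> at
  \<open>z = (s + d)\<^sup>2\<close> and \<open>z = (s - d)\<^sup>2\<close>. These two points have mean \<open>s\<^sup>2 + d\<^sup>2 > 1/2\<close>, so the larger
  one lies further away from the axis of symmetry and gives the larger value.
\<close>
lemma a_of_asymmetry:
  assumes "1 / 2 < s\<^sup>2" "s > 0" "d > 0" "s + d < 1"
  shows "a_of (s + 0) + a_of (s - 0) < a_of (s + d) + a_of (s - d)"
\<comment> \<open>The derivative vanishes at \<open>0\<close>, so it is positive on the open interval only.\<close>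
proof (rule DERIV_pos_imp_increasing_open[of 0 d "\<lambda>x. a_of (s + x) + a_of (s - x)"])
  have "s > 1 / 2"
  proof (rule ccontr)
    assume "\<not> s > 1 / 2"
    then have "s * s \<le> 1 / 2 * (1 / 2)"
      using assms by (intro mult_mono) auto
    then show False
      using assms by (simp add: power2_eq_square)
  qed
  then have b: "0 < s - x" "s - x < 1" "0 < s + x" "s + x < 1" if "0 \<le> x" "x \<le> d" for x
    using that assms by auto
  define y where "y x = 1 / ((s + x)\<^sup>2 - ((s + x)\<^sup>2)\<^sup>2) - 1 / ((s - x)\<^sup>2 - ((s - x)\<^sup>2)\<^sup>2)" for x
  have deriv: "((\<lambda>x. a_of (s + x) + a_of (s - x)) has_real_derivative y x) (at x)"
    if "0 \<le> x" "x \<le> d" for x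
    unfolding y_def
    using b[OF that] by (auto intro!: derivative_eq_intros DERIV_chain2[OF a_of_deriv])
  then show "continuous_on {0..d} (\<lambda>x. a_of (s + x) + a_of (s - x))"
    by (intro DERIV_continuous_on[where D = y]) (auto intro: has_field_derivative_at_within)
  fix x assume x: "0 < x" "x < d"
  have "((s - x)\<^sup>2 - ((s - x)\<^sup>2)\<^sup>2) - ((s + x)\<^sup>2 - ((s + x)\<^sup>2)\<^sup>2)
      = 4 * s * x * (2 * s\<^sup>2 + 2 * x\<^sup>2 - 1)"
    by algebra
  also have "\<dots> > 0"
    using x assms(1,2) zero_le_power2[of x] by (intro mult_pos_pos) linarith+
  finally have "y x > 0"
    unfolding y_def using b[of x] x a_of_deriv_pos[of "s + x"] by (simp add: frac_less2)
  with deriv[of x] x show "\<exists>y. ((\<lambda>x. a_of (s + x) + a_of (s - x)) has_real_derivative y) (at x) \<and> y > 0"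
    by auto
qed (use assms in auto)

text \<open>
  Let \<open>s = 1 / t1 0\<close> be the zero of \<open>a_of\<close>, and let \<open>s + d\<close> and \<open>r\<close> be the reciprocals of
  \<open>t1 a\<close> and \<open>t1 (-a)\<close>, where \<open>a_of\<close> takes the values \<open>a\<close> and \<open>-a\<close>. The asymmetry of \<open>a_of\<close> gives
  \<open>a_of (s - d) > -a\<close>, hence \<open>r < s - d\<close>.
\<close>
lemma inverse_t1_add_inverse_t2_less_of_pos:
  assumes "a > 0"
  shows "inverse (t1 a) + inverse (t1 (- a)) < 2 / t1 0"
proof -
  define s where "s = inverse (t1 0)"
  define d where "d = inverse (t1 a) - s"
  have s: "s > 0" "s < 1" "s \<ge> 0.8"
    unfolding s_def using t1_pos[of 0] t1_gt_1[of 0] t1_0_less by (auto simp: field_simps)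
  have "0.8 * 0.8 \<le> s * s"
    using s by (intro mult_mono) auto
  then have s2: "1 / 2 < s\<^sup>2"
    by (simp add: power2_eq_square)
  have d: "d > 0" "s + d < 1"
    unfolding d_def s_def using t1_strict_decreasing[OF assms] t1_pos[of a] t1_gt_1[of a]
    by (auto simp: field_simps)
  have a_of_s: "a_of s = 0" and a_of_sd: "a_of (s + d) = a"
    using a_of_inverse_t1 by (simp_all add: s_def d_def)
  have "a_of (s + 0) + a_of (s - 0) < a_of (s + d) + a_of (s - d)"
    by (intro a_of_asymmetry s2 s d)
  then have lt: "a_of (inverse (t1 (- a))) < a_of (s - d)"
    using a_of_s a_of_sd by (simp add: a_of_inverse_t1)
  have "inverse (t1 (- a)) < s - d"
  proof (rule ccontr)
    assume "\<not> inverse (t1 (- a)) < s - d"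
    moreover have "inverse (t1 (- a)) < 1"
      using t1_gt_1[of "- a"] by (simp add: field_simps)
    ultimately show False
      using a_of_strict_increasing[of "s - d" "inverse (t1 (- a))"] lt s d by fastforce
  qed
  then show ?thesis
    by (simp add: d_def s_def field_simps)
qed

lemma inverse_t1_add_inverse_t2_less:
  assumes "a \<noteq> 0"
  shows "inverse (t1 a) + inverse (t2 a) < 2 / t1 0"
proof (cases "a > 0")
  case True
  then show ?thesis
    using inverse_t1_add_inverse_t2_less_of_pos[of a] by (simp only: t2_eq_t1)
next
  case False
  then have "- a > 0"
    using assms by simp
  then show ?thesis
    using inverse_t1_add_inverse_t2_less_of_pos[of "- a"] by (simp only: t2_eq_t1 minus_minus add.commute)
qed

section \<open>The eigenvalue of the first angular mode\<close>

text \<open>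
  \<open>lambda11\<close> is the smaller root of the quadratic polynomial that the boundary conditions
  impose on the mode \<open>(A sinh t + B cosh t) cos \<theta>\<close>. The factorization yields the sign of the
  polynomial below the larger root \<open>\<mu>\<close>; the last bound says that \<open>\<mu>\<close> exceeds the mean of \<open>1 / f 0\<close>
  and \<open>1 / f T\<close>.
\<close>
lemma lambda11_factor:
  fixes c :: real
  assumes pos: "f 0 > 0" "f T > 0" and T: "T > 0"
  defines "c \<equiv> coth T"
  obtains \<mu> where
    "\<And>x. f 0 * f T * x\<^sup>2 - (f 0 + f T) * c * x + 1 = f 0 * f T * (x - lambda11 T f) * (x - \<mu>)"
    "0 < lambda11 T f" "lambda11 T f < \<mu>" "f 0 + f T < 2 * f 0 * f T * \<mu>"
proof -
  define s where "s = inverse (f 0) + inverse (f T)"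
  define p where "p = inverse (f 0) * inverse (f T)"
  define D where "D = s\<^sup>2 * c\<^sup>2 - 4 * p"
  define \<mu> where "\<mu> = (s * c + sqrt D) / 2"
  have c: "c > 1"
    using coth_gt_1[OF T] by (simp add: c_def)
  have p: "p > 0" and s: "s > 0"
    using pos by (simp_all add: p_def s_def add_pos_pos)
  have "s\<^sup>2 - 4 * p = (inverse (f 0) - inverse (f T))\<^sup>2"
    by (simp add: s_def p_def power2_eq_square algebra_simps)
  then have "4 * p \<le> s\<^sup>2"
    by (smt (verit) zero_le_power2)
  also have "s\<^sup>2 < s\<^sup>2 * c\<^sup>2"
    using s c by (simp add: power2_eq_square less_1_mult)
  finally have D: "D > 0"
    by (simp add: D_def)
  have l: "lambda11 T f = (s * c - sqrt D) / 2"
    unfolding lambda11_def Let_def s_def D_def p_def c_def by (simp add: mult.assoc)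
  have sum: "lambda11 T f + \<mu> = s * c"
    by (simp add: l \<mu>_def field_simps)
  have "4 * ((u - v) / 2 * ((u + v) / 2)) = u\<^sup>2 - v\<^sup>2" for u v :: real
    by (simp add: power2_eq_square square_diff_square_factored)
  then have "4 * (lambda11 T f * \<mu>) = (s * c)\<^sup>2 - (sqrt D)\<^sup>2"
    unfolding l \<mu>_def by blast
  also have "\<dots> = 4 * p"
    using D by (simp add: D_def power_mult_distrib)
  finally have prod: "lambda11 T f * \<mu> = p"
    by (simp only: mult_cancel_left) simp
  show thesis
  proof
    have fs: "f 0 * f T * s = f 0 + f T" "f 0 * f T * p = 1"
      using pos by (simp_all add: s_def p_def field_simps)
    show "f 0 * f T * x\<^sup>2 - (f 0 + f T) * c * x + 1 = f 0 * f T * (x - lambda11 T f) * (x - \<mu>)" for x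
      using fs sum prod by algebra
    have "\<mu> > 0"
      using s c D by (simp add: \<mu>_def add_pos_pos)
    with prod p show "lambda11 T f > 0"
      by (metis zero_less_mult_pos2)
    show "lambda11 T f < \<mu>"
      using D by (simp add: l \<mu>_def)
    have "s < 2 * \<mu>"
      using s c D by (simp add: \<mu>_def) (smt (verit) mult_le_cancel_left1 real_sqrt_gt_zero)
    then have "f 0 * f T * s < f 0 * f T * (2 * \<mu>)"
      using pos by simp
    then show "f 0 + f T < 2 * f 0 * f T * \<mu>"
      unfolding fs by (simp add: mult_ac)
  qed
qed

lemma lambda11_pos:
  assumes "f 0 > 0" "f T > 0" "T > 0"
  shows "lambda11 T f > 0"
  using lambda11_factor[OF assms] by metis

lemma lambda11_root:
  assumes "f 0 > 0" "f T > 0" "T > 0"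
  shows "f 0 * f T * (lambda11 T f)\<^sup>2 - (f 0 + f T) * coth T * lambda11 T f + 1 = 0"
  using lambda11_factor[OF assms] by (metis diff_self mult_zero_left mult_zero_right)

text \<open>
  At \<open>x = coth T / f 0\<close> and at \<open>x = coth T / f T\<close> the quadratic polynomial takes the value
  \<open>1 - coth\<^sup>2 T < 0\<close>, so these points lie above the smaller root.
\<close>
lemma lambda11_less_coth:
  assumes "f 0 > 0" "f T > 0" "T > 0"
  shows "lambda11 T f * f 0 < coth T" "lambda11 T f * f T < coth T"
proof -
  obtain \<mu> where \<mu>:
    "\<And>x. f 0 * f T * x\<^sup>2 - (f 0 + f T) * coth T * x + 1 = f 0 * f T * (x - lambda11 T f) * (x - \<mu>)"
    "lambda11 T f < \<mu>"
    using lambda11_factor[OF assms] by metis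
  have c: "1 < (coth T)\<^sup>2"
    using coth_gt_1[OF assms(3)] by (simp add: power2_eq_square less_1_mult)
  have *: "lambda11 T f < x" if "f 0 * f T * x\<^sup>2 - (f 0 + f T) * coth T * x + 1 < 0" for x
  proof (rule ccontr)
    assume "\<not> lambda11 T f < x"
    then have "0 \<le> (x - lambda11 T f) * (x - \<mu>)"
      using \<mu>(2) by (intro mult_nonpos_nonpos) auto
    then have "0 \<le> f 0 * f T * ((x - lambda11 T f) * (x - \<mu>))"
      using assms by simp
    then show False
      using that unfolding \<mu>(1) by (simp add: mult_ac)
  qed
  have "f 0 * f T * (coth T / f 0)\<^sup>2 - (f 0 + f T) * coth T * (coth T / f 0) + 1 = 1 - (coth T)\<^sup>2"
    using assms by (simp add: field_simps power2_eq_square)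
  with *[of "coth T / f 0"] c assms show "lambda11 T f * f 0 < coth T"
    by (simp add: field_simps)
  have "f 0 * f T * (coth T / f T)\<^sup>2 - (f 0 + f T) * coth T * (coth T / f T) + 1 = 1 - (coth T)\<^sup>2"
    using assms by (simp add: field_simps power2_eq_square)
  with *[of "coth T / f T"] c assms show "lambda11 T f * f T < coth T"
    by (simp add: field_simps)
qed

text \<open>
  A point \<open>l\<close> below \<open>1 / f 0\<close> and \<open>1 / f T\<close> lies below the larger root, so there the quadratic
  polynomial is positive, zero or negative according as \<open>l\<close> is less than, equal to or greater than
  \<open>lambda11\<close>. If \<open>l * f 0 = tanh y\<close> and \<open>l * f T = tanh x\<close>, the addition formula for \<open>tanh\<close> gives it
  the value \<open>(tanh x + tanh y) (coth (x + y) - coth T)\<close>, whose sign is that of \<open>T - (x + y)\<close>.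
\<close>
lemma lambda11_compare:
  assumes "f 0 > 0" "f T > 0" "T > 0" and xy: "x > 0" "y > 0"
    and l: "l * f 0 = tanh y" "l * f T = tanh x"
  shows "l \<le> lambda11 T f \<longleftrightarrow> x + y \<le> T" "lambda11 T f \<le> l \<longleftrightarrow> T \<le> x + y"
proof -
  obtain \<mu> where \<mu>:
    "\<And>x. f 0 * f T * x\<^sup>2 - (f 0 + f T) * coth T * x + 1 = f 0 * f T * (x - lambda11 T f) * (x - \<mu>)"
    "f 0 + f T < 2 * f 0 * f T * \<mu>"
    using lambda11_factor[OF assms(1-3)] by metis
  define q where "q = f 0 * f T * l\<^sup>2 - (f 0 + f T) * coth T * l + 1"
  have "l < \<mu>"
  proof -
    have "f 0 * f T * (2 * l) = tanh y * f T + tanh x * f 0"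
      by (simp add: l(1)[symmetric] l(2)[symmetric] algebra_simps)
    also have "\<dots> < f T + f 0"
      using assms tanh_real_lt_1[of x] tanh_real_lt_1[of y] by (intro add_strict_mono) auto
    finally have "f 0 * f T * (2 * l) < f T + f 0" .
    then show ?thesis
    proof -
      have "f 0 * f T * (2 * l) < f 0 * f T * (2 * \<mu>)"
        using \<open>f 0 * f T * (2 * l) < f T + f 0\<close> \<mu>(2) by linarith
      then show ?thesis
        using assms(1,2) by simp
    qed
  qed
  then have neg: "f 0 * f T * (l - \<mu>) < 0"
    using assms(1,2) by (simp add: mult_pos_neg)
  have "q = (l - lambda11 T f) * (f 0 * f T * (l - \<mu>))"
    unfolding q_def \<mu>(1) by simp
  then obtain N where N: "N < 0" and q1: "q = (l - lambda11 T f) * N"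
    using neg by blast
  have "q = 1 + tanh x * tanh y - (tanh x + tanh y) * coth T"
    unfolding q_def l[symmetric] by algebra
  also have "\<dots> = (tanh x + tanh y) * (coth (x + y) - coth T)"
  proof -
    have "(tanh x + tanh y) * coth (x + y) = 1 + tanh x * tanh y"
    proof -
      have "sinh (x + y) \<noteq> 0"
        using xy by simp
      moreover have "tanh x + tanh y = sinh (x + y) / (cosh x * cosh y)"
        by (simp add: tanh_def sinh_add field_simps)
      moreover have "1 + tanh x * tanh y = cosh (x + y) / (cosh x * cosh y)"
        by (simp add: tanh_def cosh_add field_simps)
      ultimately show ?thesis
        by (simp add: coth_def)
    qed
    then show ?thesis
      by (simp add: right_diff_distrib)
  qed
  finally have q2: "q = (tanh x + tanh y) * (coth (x + y) - coth T)" .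
  have "tanh x + tanh y > 0"
    using xy by (simp add: add_pos_pos)
  then have "(q \<ge> 0 \<longleftrightarrow> x + y \<le> T) \<and> (q \<le> 0 \<longleftrightarrow> T \<le> x + y)"
    unfolding q2 zero_le_mult_iff mult_le_0_iff
    using xy assms(3) coth_strict_decreasing[of T "x + y"] coth_strict_decreasing[of "x + y" T]
    by (smt (verit))
  moreover have "(q \<ge> 0 \<longleftrightarrow> l \<le> lambda11 T f) \<and> (q \<le> 0 \<longleftrightarrow> lambda11 T f \<le> l)"
    unfolding q1 zero_le_mult_iff mult_le_0_iff using N by auto
  ultimately show "l \<le> lambda11 T f \<longleftrightarrow> x + y \<le> T" "lambda11 T f \<le> l \<longleftrightarrow> T \<le> x + y"
    by auto
qed

section \<open>Completeness of the trigonometric system\<close>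

text \<open>
  Phases replace the distinction between sines and cosines, and integer frequencies of either
  sign are allowed, so that products of such functions are again sums of such functions.
\<close>
definition trig_orthogonal :: "real \<Rightarrow> (real \<Rightarrow> real) \<Rightarrow> bool" where
  "trig_orthogonal b w \<longleftrightarrow> continuous_on {b..b + 2 * pi} w \<and>
     (\<forall>(k::int) \<phi>. ((\<lambda>\<theta>. w \<theta> * cos (k * \<theta> - \<phi>)) has_integral 0) {b..b + 2 * pi})"

text \<open>
  The multipliers that preserve orthogonality to the trigonometric system are closed under
  sums and products. Hence it is enough to treat \<open>cos\<close> and \<open>sin\<close>, that is, linear functionals of
  \<open>cis \<theta>\<close>, and there the product formulas shift the frequency by one. This avoids any expansion of
  a polynomial in \<open>cos\<close> and \<open>sin\<close> into a trigonometric sum.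
\<close>
lemma trig_orthogonal_mult_polynomial:
  fixes P :: "complex \<Rightarrow> real"
  assumes "real_polynomial_function P" "trig_orthogonal b w"
  shows "trig_orthogonal b (\<lambda>\<theta>. w \<theta> * P (cis \<theta>))"
  using assms
proof (induction arbitrary: w)
  case (linear P)
  interpret bounded_linear P by fact
  define A B where "A = P 1" and "B = P \<i>"
  have P: "P (cis \<theta>) = A * cos \<theta> + B * sin \<theta>" for \<theta>
  proof -
    have "cis \<theta> = cos \<theta> *\<^sub>R 1 + sin \<theta> *\<^sub>R \<i>"
      by (simp add: complex_eq_iff)
    then have "P (cis \<theta>) = P (cos \<theta> *\<^sub>R 1 + sin \<theta> *\<^sub>R \<i>)"
      by simp
    then show ?thesis
      unfolding A_def B_def add scale by simp
  qed
  note w = linear.prems[unfolded trig_orthogonal_def]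
  have "((\<lambda>\<theta>. w \<theta> * P (cis \<theta>) * cos (k * \<theta> - \<phi>)) has_integral 0) {b..b + 2 * pi}"
    for k :: int and \<phi>
  proof -
    have split: "w \<theta> * P (cis \<theta>) * cos (k * \<theta> - \<phi>) =
        A / 2 * (w \<theta> * cos (of_int (k + 1) * \<theta> - \<phi>)) +
        A / 2 * (w \<theta> * cos (of_int (k - 1) * \<theta> - \<phi>)) +
        (B / 2 * (w \<theta> * cos (of_int (k + 1) * \<theta> - (\<phi> + pi / 2))) +
        B / 2 * (w \<theta> * cos (of_int (k - 1) * \<theta> - (\<phi> - pi / 2))))" for \<theta> :: real
    proof -
      define x where "x = k * \<theta> - \<phi>"
      have "of_int (k + 1) * \<theta> - \<phi> = x + \<theta>" "of_int (k - 1) * \<theta> - \<phi> = x - \<theta>"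
        "of_int (k + 1) * \<theta> - (\<phi> + pi / 2) = x + \<theta> - pi / 2"
        "of_int (k - 1) * \<theta> - (\<phi> - pi / 2) = pi / 2 - (\<theta> - x)"
        by (simp_all add: x_def algebra_simps)
      then show ?thesis
        unfolding P x_def[symmetric]
        by (simp add: cos_add cos_diff sin_add sin_diff algebra_simps)
    qed
    have "((\<lambda>\<theta>. w \<theta> * cos (of_int j * \<theta> - \<psi>)) has_integral 0) {b..b + 2 * pi}" for j \<psi>
      using w by blast
    note int = has_integral_mult_right[OF this]
    from has_integral_add[OF has_integral_add[OF int int] has_integral_add[OF int int]]
    show ?thesis
      by (rule has_integral_eq_rhs[OF has_integral_eq[OF split[symmetric]]]) simp
  qed
  moreover have "continuous_on {b..b + 2 * pi} (\<lambda>\<theta>. w \<theta> * P (cis \<theta>))"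
    unfolding P using w by (auto intro!: continuous_intros)
  ultimately show ?case
    by (simp add: trig_orthogonal_def)
next
  case (const c)
  have "((\<lambda>\<theta>. w \<theta> * c * cos (k * \<theta> - \<phi>)) has_integral 0) {b..b + 2 * pi}" for k :: int and \<phi>
    using has_integral_mult_right[of "\<lambda>\<theta>. w \<theta> * cos (k * \<theta> - \<phi>)" 0 _ c] const
    by (simp add: trig_orthogonal_def mult_ac)
  then show ?case
    using const by (auto simp: trig_orthogonal_def intro!: continuous_intros)
next
  case (add P Q)
  have "((\<lambda>\<theta>. w \<theta> * (P (cis \<theta>) + Q (cis \<theta>)) * cos (k * \<theta> - \<phi>)) has_integral 0) {b..b + 2 * pi}"
    for k :: int and \<phi>
    using add.IH[OF add.prems] has_integral_add[of "\<lambda>\<theta>. w \<theta> * P (cis \<theta>) * cos (k * \<theta> - \<phi>)" 0 _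
        "\<lambda>\<theta>. w \<theta> * Q (cis \<theta>) * cos (k * \<theta> - \<phi>)" 0]
    by (simp add: trig_orthogonal_def algebra_simps)
  moreover have "continuous_on {b..b + 2 * pi} (\<lambda>\<theta>. w \<theta> * P (cis \<theta>) + w \<theta> * Q (cis \<theta>))"
    using add.IH[OF add.prems] by (auto simp: trig_orthogonal_def intro!: continuous_intros)
  ultimately show ?case
    by (simp add: trig_orthogonal_def distrib_left)
next
  case (mult P Q)
  from mult.IH(2)[OF mult.IH(1)[OF mult.prems]] show ?case
    by (simp add: mult_ac)
qed

text \<open>
  The map \<open>cis\<close> from the closed interval onto the circle is a closed map, since the interval
  is compact, and its only identification is that of the two end points.
\<close>
lemma periodic_factor_through_circle:
  fixes g :: "real \<Rightarrow> real"
  assumes cont: "continuous_on {b..b + 2 * pi} g" and per: "g (b + 2 * pi) = g b"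
  obtains G :: "complex \<Rightarrow> real" where
    "continuous_on (sphere 0 1) G" "\<And>\<theta>. \<theta> \<in> {b..b + 2 * pi} \<Longrightarrow> G (cis \<theta>) = g \<theta>"
proof -
  define I where "I = {b..b + 2 * pi}"
  define G where "G z = g (SOME \<theta>. \<theta> \<in> I \<and> cis \<theta> = z)" for z
  have same: "g \<theta> = g \<theta>'" if "\<theta> \<in> I" "\<theta>' \<in> I" "cis \<theta> = cis \<theta>'" for \<theta> \<theta>'
  proof -
    from that(3) have "sin \<theta> = sin \<theta>' \<and> cos \<theta> = cos \<theta>'"
      by (simp add: complex_eq_iff)
    then obtain n :: int where n: "\<theta> = \<theta>' + 2 * pi * n"
      unfolding sin_cos_eq_iff by blast
    have "\<bar>2 * pi * n\<bar> \<le> 2 * pi"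
      using n that(1,2) by (auto simp: I_def)
    then have "\<bar>n\<bar> \<le> 1"
      by (simp add: abs_mult)
    then consider "n = 0" | "n = 1" | "n = -1"
      by linarith
    then show ?thesis
    proof cases
      case 2
      then have "\<theta> = b + 2 * pi" "\<theta>' = b"
        using n that by (auto simp: I_def)
      then show ?thesis using per by simp
    next
      case 3
      then have "\<theta>' = b + 2 * pi" "\<theta> = b"
        using n that by (auto simp: I_def)
      then show ?thesis using per by simp
    qed (use n in auto)
  qed
  have G: "G (cis \<theta>) = g \<theta>" if "\<theta> \<in> I" for \<theta>
  proof -
    define \<theta>' where "\<theta>' = (SOME \<theta>'. \<theta>' \<in> I \<and> cis \<theta>' = cis \<theta>)"
    have "\<theta>' \<in> I \<and> cis \<theta>' = cis \<theta>"
      unfolding \<theta>'_def by (rule someI[of _ \<theta>]) (use that in auto)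
    then show ?thesis
      using same that unfolding G_def \<theta>'_def by blast
  qed
  have surj: "\<exists>\<theta>\<in>I. z = cis \<theta>" if "z \<in> sphere 0 1" for z
  proof -
    \<comment> \<open>The argument is shifted by the multiple of \<open>2\<pi>\<close> that brings it into the interval.\<close>
    define n where "n = \<lceil>(b - Arg z) / (2 * pi)\<rceil>"
    have "(b - Arg z) / (2 * pi) \<le> n" "n < (b - Arg z) / (2 * pi) + 1"
      unfolding n_def by linarith+
    then have "b - Arg z \<le> 2 * pi * n" "2 * pi * n < b - Arg z + 2 * pi"
      by (simp_all add: field_simps)
    then have "Arg z + 2 * pi * n \<in> I"
      by (auto simp: I_def)
    moreover have "cis (Arg z + 2 * pi * n) = z"
    proof -
      have "cis (Arg z + 2 * pi * n) = cis (Arg z)"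
        using sin_cos_eq_iff by (auto simp: complex_eq_iff)
      also have "\<dots> = z"
        using that cis_Arg[of z] by (cases "z = 0") (auto simp: sgn_div_norm)
      finally show ?thesis .
    qed
    ultimately show ?thesis
      by metis
  qed
  have "closed (G -` B \<inter> sphere 0 1)" if "closed B" for B
  proof -
    have "G -` B \<inter> sphere 0 1 = cis ` (g -` B \<inter> I)"
    proof (intro equalityI subsetI)
      fix z assume z: "z \<in> G -` B \<inter> sphere 0 1"
      then obtain \<theta> where "\<theta> \<in> I" "z = cis \<theta>"
        using surj by blast
      then show "z \<in> cis ` (g -` B \<inter> I)"
        using z G by auto
    qed (use G in auto)
    moreover have "compact (g -` B \<inter> I)"
    proof -
      have "closed (g -` B \<inter> I)"
        using cont that continuous_on_closed_vimage[of I g] by (simp add: I_def)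
      then have "compact (I \<inter> (g -` B \<inter> I))"
        by (intro compact_Int_closed) (auto simp: I_def)
      then show ?thesis
        by (simp add: Int_commute Int_left_commute)
    qed
    moreover have "continuous_on (g -` B \<inter> I) cis"
      unfolding cis_conv_exp by (intro continuous_intros)
    ultimately show ?thesis
      by (metis compact_continuous_image compact_imp_closed)
  qed
  then have "continuous_on (sphere 0 1) G"
    by (subst continuous_on_closed_vimage) auto
  then show thesis
    using that G unfolding I_def by blast
qed

text \<open>
  By the Stone-Weierstrass theorem \<open>g\<close> is a uniform limit of polynomials in \<open>cis \<theta>\<close>. As \<open>g\<close> is
  orthogonal to all of these, it is orthogonal to itself.
\<close>
lemma trig_orthogonal_imp_zero:
  assumes "trig_orthogonal b g" and per: "g (b + 2 * pi) = g b" and "\<theta> \<in> {b..b + 2 * pi}"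
  shows "g \<theta> = 0"
proof -
  define I where "I = {b..b + 2 * pi}"
  have cont: "continuous_on I g"
    using assms(1) by (simp add: trig_orthogonal_def I_def)
  obtain G :: "complex \<Rightarrow> real" where G: "continuous_on (sphere 0 1) G" "\<And>\<theta>. \<theta> \<in> I \<Longrightarrow> G (cis \<theta>) = g \<theta>"
    using periodic_factor_through_circle[OF cont[unfolded I_def] per] unfolding I_def by metis
  obtain M where M: "\<And>\<theta>. \<theta> \<in> I \<Longrightarrow> \<bar>g \<theta>\<bar> \<le> M"
  proof -
    have "compact (g ` I)"
      using cont by (intro compact_continuous_image) (auto simp: I_def)
    then show thesis
      using that by (metis bounded_real compact_imp_bounded image_eqI)
  qed
  have "M \<ge> 0"
    using M[of b] by (force simp: I_def)
  define E where "E = integral I (\<lambda>\<theta>. g \<theta> * g \<theta>)"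
  have small: "E \<le> \<epsilon> * (M * (2 * pi))" if \<epsilon>: "\<epsilon> > 0" for \<epsilon>
  proof -
    obtain P where P: "real_polynomial_function P" "\<And>z. z \<in> sphere 0 1 \<Longrightarrow> \<bar>G z - P z\<bar> < \<epsilon>"
      using Stone_Weierstrass_real_polynomial_function[OF compact_sphere G(1) \<epsilon>] by metis
    have "trig_orthogonal b (\<lambda>\<theta>. g \<theta> * P (cis \<theta>))"
      by (intro trig_orthogonal_mult_polynomial P assms(1))
    then have "((\<lambda>\<theta>. g \<theta> * P (cis \<theta>) * cos (of_int 0 * \<theta> - 0)) has_integral 0) I"
      unfolding trig_orthogonal_def I_def by blast
    then have 1: "((\<lambda>\<theta>. g \<theta> * P (cis \<theta>)) has_integral 0) I"
      by simp
    have 2: "((\<lambda>\<theta>. g \<theta> * g \<theta>) has_integral E) I"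
      unfolding E_def I_def using cont
      by (intro integrable_integral integrable_continuous_real continuous_intros) (auto simp: I_def)
    have 3: "((\<lambda>\<theta>. M * \<epsilon>) has_integral (2 * pi * (M * \<epsilon>))) I"
      using has_integral_const_real[of "M * \<epsilon>" b "b + 2 * pi"] by (simp add: I_def)
    have "E - 0 \<le> 2 * pi * (M * \<epsilon>)"
    proof (rule has_integral_le[OF has_integral_diff[OF 2 1] 3])
      fix \<theta> assume \<theta>: "\<theta> \<in> I"
      have "g \<theta> * g \<theta> - g \<theta> * P (cis \<theta>) = g \<theta> * (G (cis \<theta>) - P (cis \<theta>))"
        using G(2)[OF \<theta>] by (simp add: algebra_simps)
      also have "\<dots> \<le> \<bar>g \<theta>\<bar> * \<bar>G (cis \<theta>) - P (cis \<theta>)\<bar>"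
        by (metis abs_ge_self abs_mult)
      also have "\<dots> \<le> M * \<epsilon>"
        using M[OF \<theta>] P(2)[of "cis \<theta>"] \<open>M \<ge> 0\<close> by (intro mult_mono) auto
      finally show "g \<theta> * g \<theta> - g \<theta> * P (cis \<theta>) \<le> M * \<epsilon>" .
    qed
    then show ?thesis
      by (simp add: mult_ac)
  qed
  have "E \<le> 0"
  proof (rule field_le_epsilon)
    fix e :: real assume "e > 0"
    define K where "K = M * (2 * pi) + 1"
    have "K > 0"
      using \<open>M \<ge> 0\<close> by (simp add: K_def add_nonneg_pos)
    have "E \<le> e / K * (M * (2 * pi))"
      using \<open>e > 0\<close> \<open>K > 0\<close> by (intro small) auto
    also have "\<dots> \<le> e / K * K"
      using \<open>e > 0\<close> \<open>K > 0\<close> by (intro mult_left_mono) (auto simp: K_def)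
    finally show "E \<le> 0 + e"
      using \<open>K > 0\<close> by simp
  qed
  moreover have "E \<ge> 0"
    unfolding E_def I_def using cont
    by (intro integral_nonneg integrable_continuous_real continuous_intros) (auto simp: I_def)
  ultimately have "integral I (\<lambda>\<theta>. g \<theta> * g \<theta>) = 0"
    by (simp add: E_def)
  moreover have "continuous_on I (\<lambda>\<theta>. g \<theta> * g \<theta>)"
    by (intro continuous_intros cont)
  ultimately have "\<forall>\<theta>\<in>I. g \<theta> * g \<theta> = 0"
    unfolding I_def by (subst (asm) integral_eq_0_iff) simp_all
  then have "g \<theta> * g \<theta> = 0"
    using assms(3) by (simp only: I_def)
  then show ?thesis by simp
qed

section \<open>Fourier modes of harmonic functions on the cylinder\<close>

lemma vector_derivative_cong_within:
  assumes "t \<in> S" "\<And>s. s \<in> S \<Longrightarrow> f s = g s"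
  shows "vector_derivative f (at t within S) = vector_derivative g (at t within S)"
  using assms by (intro vector_derivative_cong_eq) (auto intro: always_eventually)

lemma partial_t_eqI:
  assumes "T > 0" "t \<in> {0..T}"
    and "((\<lambda>s. u (s, \<theta>)) has_real_derivative d) (at t within {0..T})"
  shows "partial_t T u (t, \<theta>) = d"
  using assms vector_derivative_within_cbox[of 0 T t "\<lambda>s. u (s, \<theta>)" d]
  by (simp add: partial_t_def has_real_derivative_iff_has_vector_derivative)

lemma partial_theta_eqI:
  assumes "((\<lambda>s. u (t, s)) has_real_derivative d) (at \<theta>)"
  shows "partial_theta u (t, \<theta>) = d"
  using assms vector_derivative_at
  by (auto simp: partial_theta_def has_real_derivative_iff_has_vector_derivative)

text \<open>
  The witness in \<open>smooth_on_cylinder\<close>: \<open>D i j\<close> is \<open>\<partial>\<^sub>t\<^sup>i \<partial>\<^sub>\<theta>\<^sup>j u\<close>. Fixing it once allows the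
  one-sided derivatives in the definition of the Laplacian to be replaced by values of \<open>D\<close>.
\<close>
definition cylinder_derivatives ::
  "real \<Rightarrow> (real \<times> real \<Rightarrow> real) \<Rightarrow> (nat \<Rightarrow> nat \<Rightarrow> real \<times> real \<Rightarrow> real) \<Rightarrow> bool" where
  "cylinder_derivatives T u D \<longleftrightarrow>
     (\<forall>p\<in>strip T. D 0 0 p = u p) \<and>
     (\<forall>i j. continuous_on (strip T) (D i j)) \<and>
     (\<forall>i j. \<forall>t\<in>{0..T}. \<forall>\<theta>.
        ((\<lambda>s. D i j (s, \<theta>)) has_real_derivative D (Suc i) j (t, \<theta>)) (at t within {0..T}) \<and>
        ((\<lambda>s. D i j (t, s)) has_real_derivative D i (Suc j) (t, \<theta>)) (at \<theta>))"

lemma smooth_on_cylinder_iff: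
  "smooth_on_cylinder T u \<longleftrightarrow>
     (\<forall>t\<in>{0..T}. \<forall>\<theta>. u (t, \<theta> + 2 * pi) = u (t, \<theta>)) \<and> (\<exists>D. cylinder_derivatives T u D)"
  unfolding smooth_on_cylinder_def cylinder_derivatives_def by blast

context
  fixes T :: real and u :: "real \<times> real \<Rightarrow> real" and D :: "nat \<Rightarrow> nat \<Rightarrow> real \<times> real \<Rightarrow> real"
  assumes T: "T > 0" and D: "cylinder_derivatives T u D"
begin

lemma cylinder_derivatives_0: "t \<in> {0..T} \<Longrightarrow> D 0 0 (t, \<theta>) = u (t, \<theta>)"
  using D by (simp add: cylinder_derivatives_def strip_def)

lemma cylinder_derivatives_t:
  "t \<in> {0..T} \<Longrightarrow>
    ((\<lambda>s. D i j (s, \<theta>)) has_real_derivative D (Suc i) j (t, \<theta>)) (at t within {0..T})"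
  using D by (simp add: cylinder_derivatives_def)

lemma cylinder_derivatives_theta:
  "t \<in> {0..T} \<Longrightarrow> ((\<lambda>s. D i j (t, s)) has_real_derivative D i (Suc j) (t, \<theta>)) (at \<theta>)"
  using D by (simp add: cylinder_derivatives_def)

lemma cylinder_derivatives_continuous: "continuous_on (strip T) (D i j)"
  using D by (simp add: cylinder_derivatives_def)

lemma partial_t_cylinder:
  assumes "t \<in> {0..T}"
  shows "partial_t T u (t, \<theta>) = D 1 0 (t, \<theta>)"
proof -
  have "partial_t T u (t, \<theta>) = partial_t T (D 0 0) (t, \<theta>)"
    unfolding partial_t_def prod.case using assms cylinder_derivatives_0
    by (intro vector_derivative_cong_within) auto
  also have "\<dots> = D 1 0 (t, \<theta>)"
    using cylinder_derivatives_t[OF assms, of 0 0 \<theta>] by (intro partial_t_eqI T assms) simp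
  finally show ?thesis .
qed

lemma partial_t_t_cylinder:
  assumes "t \<in> {0..T}"
  shows "partial_t T (partial_t T u) (t, \<theta>) = D 2 0 (t, \<theta>)"
proof -
  have "partial_t T (partial_t T u) (t, \<theta>) = partial_t T (D 1 0) (t, \<theta>)"
    unfolding partial_t_def[of T "partial_t T u"] partial_t_def[of T "D 1 0"] prod.case
    using assms partial_t_cylinder by (intro vector_derivative_cong_within) auto
  also have "\<dots> = D 2 0 (t, \<theta>)"
    using cylinder_derivatives_t[OF assms, of 1 0 \<theta>]
    by (intro partial_t_eqI T assms) (simp add: numeral_2_eq_2)
  finally show ?thesis .
qed

lemma partial_theta_theta_cylinder:
  assumes "t \<in> {0..T}"
  shows "partial_theta (partial_theta u) (t, \<theta>) = D 0 2 (t, \<theta>)"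
proof -
  have "partial_theta u (t, s) = D 0 1 (t, s)" for s
    using cylinder_derivatives_theta[OF assms, of 0 0 s] cylinder_derivatives_0[OF assms]
    by (intro partial_theta_eqI) simp
  then have "partial_theta (partial_theta u) (t, \<theta>) = partial_theta (D 0 1) (t, \<theta>)"
    by (simp add: partial_theta_def)
  also have "\<dots> = D 0 2 (t, \<theta>)"
    using cylinder_derivatives_theta[OF assms, of 0 1 \<theta>]
    by (intro partial_theta_eqI) (simp add: numeral_2_eq_2)
  finally show ?thesis .
qed

lemma laplacian_cylinder:
  assumes "t \<in> {0..T}"
  shows "laplacian T f u (t, \<theta>) = (D 2 0 (t, \<theta>) + D 0 2 (t, \<theta>)) / (f t)\<^sup>2"
  using partial_t_t_cylinder partial_theta_theta_cylinder assms by (simp add: laplacian_def)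

lemma has_derivative_integral_theta:
  assumes "t \<in> {0..T}" and w: "continuous_on UNIV w"
  shows "((\<lambda>t. integral {b..c} (\<lambda>\<theta>. D i j (t, \<theta>) * w \<theta>)) has_real_derivative
           integral {b..c} (\<lambda>\<theta>. D (Suc i) j (t, \<theta>) * w \<theta>)) (at t within {0..T})"
proof -
  have cont: "continuous_on ({0..T} \<times> {b..c}) (\<lambda>(t, \<theta>). D i j (t, \<theta>) * w \<theta>)" for i j
    unfolding case_prod_unfold prod.collapse
    by (intro continuous_intros continuous_on_subset[OF cylinder_derivatives_continuous]
        continuous_on_compose2[OF w]) (auto simp: strip_def)
  have "((\<lambda>t. integral (cbox b c) (\<lambda>\<theta>. D i j (t, \<theta>) * w \<theta>)) has_real_derivative
           integral (cbox b c) (\<lambda>\<theta>. D (Suc i) j (t, \<theta>) * w \<theta>)) (at t within {0..T})"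
  proof (rule leibniz_rule_field_derivative)
    show "((\<lambda>t. D i j (t, \<theta>) * w \<theta>) has_real_derivative D (Suc i) j (t, \<theta>) * w \<theta>) (at t within {0..T})"
      if "t \<in> {0..T}" for t \<theta>
      using cylinder_derivatives_t[OF that] by (intro DERIV_cmult_right)
    show "(\<lambda>\<theta>. D i j (t, \<theta>) * w \<theta>) integrable_on cbox b c" if "t \<in> {0..T}" for t
    proof -
      have "continuous_on {b..c} (\<lambda>\<theta>. (\<lambda>(t, \<theta>). D i j (t, \<theta>) * w \<theta>) (t, \<theta>))"
        using that by (intro continuous_on_compose2[OF cont] continuous_intros) auto
      then show ?thesis
        by (simp add: integrable_continuous_real)
    qed
  qed (use assms cont in auto)
  then show ?thesis by simp
qed

text \<open>
  Integration by parts, twice; the boundary terms cancel because \<open>u\<close>, and hence \<open>\<partial>\<^sub>\<theta> u\<close>, is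
  periodic and the frequency is an integer.
\<close>
lemma integral_theta_theta:
  assumes t: "t \<in> {0..T}" and per: "\<And>\<theta>. u (t, \<theta> + 2 * pi) = u (t, \<theta>)"
  shows "integral {b..b + 2 * pi} (\<lambda>\<theta>. D 0 2 (t, \<theta>) * cos (of_int k * \<theta> - \<phi>)) =
         - (of_int k)\<^sup>2 * integral {b..b + 2 * pi} (\<lambda>\<theta>. D 0 0 (t, \<theta>) * cos (of_int k * \<theta> - \<phi>))"
proof -
  let ?k = "of_int k :: real"
  let ?I = "{b..b + 2 * pi}"
  have shift: "?k * (b + 2 * pi) - \<phi> = (?k * b - \<phi>) + 2 * pi * ?k"
    by (simp add: algebra_simps)
  have trig: "cos (?k * (b + 2 * pi) - \<phi>) = cos (?k * b - \<phi>)" "sin (?k * (b + 2 * pi) - \<phi>) = sin (?k * b - \<phi>)"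
    unfolding shift using sin_cos_eq_iff by blast+
  have per0: "D 0 0 (t, \<theta> + 2 * pi) = D 0 0 (t, \<theta>)" for \<theta>
    using per cylinder_derivatives_0[OF t] by simp
  have per1: "D 0 1 (t, b + 2 * pi) = D 0 1 (t, b)"
  proof -
    have "((\<lambda>s. D 0 0 (t, s)) has_real_derivative D 0 1 (t, b + 2 * pi)) (at (b + 2 * pi))"
      using cylinder_derivatives_theta[OF t, of 0 0] by simp
    then have "((\<lambda>s. D 0 0 (t, s + 2 * pi)) has_real_derivative D 0 1 (t, b + 2 * pi)) (at b)"
      by (simp add: DERIV_shift)
    then have "((\<lambda>s. D 0 0 (t, s)) has_real_derivative D 0 1 (t, b + 2 * pi)) (at b)"
      by (simp add: per0)
    moreover have "((\<lambda>s. D 0 0 (t, s)) has_real_derivative D 0 1 (t, b)) (at b)"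
      using cylinder_derivatives_theta[OF t, of 0 0] by simp
    ultimately show ?thesis
      by (rule DERIV_unique)
  qed
  \<comment> \<open>\<open>H\<close> collects the boundary terms of both integrations by parts.\<close>
  define H where "H \<theta> = D 0 1 (t, \<theta>) * cos (?k * \<theta> - \<phi>) + ?k * (D 0 0 (t, \<theta>) * sin (?k * \<theta> - \<phi>))" for \<theta>
  have "((\<lambda>\<theta>. D 0 2 (t, \<theta>) * cos (?k * \<theta> - \<phi>) + ?k\<^sup>2 * (D 0 0 (t, \<theta>) * cos (?k * \<theta> - \<phi>)))
      has_integral H (b + 2 * pi) - H b) ?I"
  proof (rule fundamental_theorem_of_calculus)
    fix \<theta>
    have "(H has_real_derivative
        D 0 2 (t, \<theta>) * cos (?k * \<theta> - \<phi>) + ?k\<^sup>2 * (D 0 0 (t, \<theta>) * cos (?k * \<theta> - \<phi>))) (at \<theta>)"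
      unfolding H_def
      using cylinder_derivatives_theta[OF t, of 0 1 \<theta>] cylinder_derivatives_theta[OF t, of 0 0 \<theta>]
      by (auto intro!: derivative_eq_intros simp: numeral_2_eq_2 algebra_simps)
    then show "(H has_vector_derivative
        D 0 2 (t, \<theta>) * cos (?k * \<theta> - \<phi>) + ?k\<^sup>2 * (D 0 0 (t, \<theta>) * cos (?k * \<theta> - \<phi>)))
        (at \<theta> within ?I)"
      unfolding has_real_derivative_iff_has_vector_derivative[symmetric]
      by (rule has_field_derivative_at_within)
  qed simp
  moreover have "H (b + 2 * pi) = H b"
    unfolding H_def trig per0 per1 ..
  ultimately have "((\<lambda>\<theta>. D 0 2 (t, \<theta>) * cos (?k * \<theta> - \<phi>) + ?k\<^sup>2 * (D 0 0 (t, \<theta>) * cos (?k * \<theta> - \<phi>)))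
      has_integral 0) ?I"
    by simp
  moreover have int: "(\<lambda>\<theta>. D 0 j (t, \<theta>) * cos (?k * \<theta> - \<phi>)) integrable_on ?I" for j
  proof -
    have "continuous_on ?I (\<lambda>\<theta>. D 0 j (t, \<theta>))"
      using cylinder_derivatives_theta[OF t, of 0 j]
      by (intro DERIV_continuous_on) (rule has_field_derivative_at_within)
    then show ?thesis
      by (intro integrable_continuous_real continuous_intros)
  qed
  ultimately have "integral ?I (\<lambda>\<theta>. D 0 2 (t, \<theta>) * cos (?k * \<theta> - \<phi>)) +
      ?k\<^sup>2 * integral ?I (\<lambda>\<theta>. D 0 0 (t, \<theta>) * cos (?k * \<theta> - \<phi>)) = 0"
    using has_integral_add[OF integrable_integral[OF int[of 2]]
        has_integral_mult_right[OF integrable_integral[OF int[of 0]], of "?k\<^sup>2"]]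
    by (rule_tac has_integral_unique)
  then show ?thesis by simp
qed

end

text \<open>
  The Fourier coefficients along the circles \<open>t = const\<close> of a harmonic function solve
  \<open>c'' = k\<^sup>2 c\<close>, and each of them inherits the boundary condition of a Dirichlet-to-Neumann
  eigenfunction, because the factor \<open>f\<close> is constant on each boundary component.
\<close>
lemma eigenfunction_mode:
  assumes T: "T > 0" and f: "\<And>t. t \<in> {0..T} \<Longrightarrow> f t > 0"
    and v: "harmonic_extension T f u v"
    and bd: "\<And>p. p \<in> strip_boundary T \<Longrightarrow> \<sigma> * u p = conormal_derivative T f v p"
  fixes k :: int and b \<phi> :: real
  defines "c \<equiv> \<lambda>t. integral {b..b + 2 * pi} (\<lambda>\<theta>. v (t, \<theta>) * cos (k * \<theta> - \<phi>))"
  obtains c' where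
    "\<And>t. t \<in> {0..T} \<Longrightarrow> (c has_real_derivative c' t) (at t within {0..T})"
    "\<And>t. t \<in> {0..T} \<Longrightarrow> (c' has_real_derivative (of_int k)\<^sup>2 * c t) (at t within {0..T})"
    "c' 0 = - (\<sigma> * f 0 * c 0)" "c' T = \<sigma> * f T * c T"
proof -
  obtain D where D: "cylinder_derivatives T v D"
    and per: "\<And>t \<theta>. t \<in> {0..T} \<Longrightarrow> v (t, \<theta> + 2 * pi) = v (t, \<theta>)"
    using v unfolding harmonic_extension_def smooth_on_cylinder_iff by blast
  note D0 = cylinder_derivatives_0[OF T D]
  define w where "w \<theta> = cos (of_int k * \<theta> - \<phi>)" for \<theta> :: real
  define C where "C i j t = integral {b..b + 2 * pi} (\<lambda>\<theta>. D i j (t, \<theta>) * w \<theta>)" for i j t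
  have w: "continuous_on UNIV w"
    unfolding w_def by (intro continuous_intros)
  have c: "c t = C 0 0 t" if "t \<in> {0..T}" for t
    using D0[OF that] by (simp add: c_def C_def w_def)
  have C': "(C i j has_real_derivative C (Suc i) j t) (at t within {0..T})" if "t \<in> {0..T}" for i j t
    using has_derivative_integral_theta[OF T D that w] unfolding C_def .
  have harm: "D 2 0 (t, \<theta>) = - D 0 2 (t, \<theta>)" if "t \<in> {0..T}" for t \<theta>
  proof -
    have "laplacian T f v (t, \<theta>) = 0"
      using v that by (simp add: harmonic_extension_def strip_def)
    then show ?thesis
      using laplacian_cylinder[OF T D that] f[OF that] by (simp add: add_eq_0_iff2)
  qed
  have C2: "C 2 0 t = (of_int k)\<^sup>2 * c t" if "t \<in> {0..T}" for t
  proof -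
    have "C 2 0 t = - C 0 2 t"
      by (simp add: C_def harm[OF that])
    also have "C 0 2 t = - (of_int k)\<^sup>2 * C 0 0 t"
      unfolding C_def w_def by (intro integral_theta_theta[OF T D that] per that)
    finally show ?thesis
      by (simp add: c[OF that])
  qed
  have bd0: "D 1 0 (0, \<theta>) = - (\<sigma> * f 0 * D 0 0 (0, \<theta>))" for \<theta>
  proof -
    have "\<sigma> * v (0, \<theta>) = - D 1 0 (0, \<theta>) / f 0"
      using bd[of "(0, \<theta>)"] v T partial_t_cylinder[OF T D, of 0 \<theta>]
      by (simp add: harmonic_extension_def strip_boundary_def conormal_derivative_def)
    then show ?thesis
      using f[of 0] T D0[of 0 \<theta>] by (simp add: field_simps)
  qed
  have bdT: "D 1 0 (T, \<theta>) = \<sigma> * f T * D 0 0 (T, \<theta>)" for \<theta>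
  proof -
    have "\<sigma> * v (T, \<theta>) = D 1 0 (T, \<theta>) / f T"
      using bd[of "(T, \<theta>)"] v T partial_t_cylinder[OF T D, of T \<theta>]
      by (simp add: harmonic_extension_def strip_boundary_def conormal_derivative_def)
    then show ?thesis
      using f[of T] T D0[of T \<theta>] by (simp add: field_simps)
  qed
  show thesis
  proof
    show "(c has_real_derivative C 1 0 t) (at t within {0..T})" if "t \<in> {0..T}" for t
      using has_field_derivative_transform_within[OF C'[OF that, of 0 0] zero_less_one that, of c] c by simp
    show "(C 1 0 has_real_derivative (of_int k)\<^sup>2 * c t) (at t within {0..T})" if "t \<in> {0..T}" for t
      using C'[OF that, of 1 0] C2[OF that] by (simp add: numeral_2_eq_2)
    have "C 1 0 0 = - (\<sigma> * f 0) * C 0 0 0"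
      unfolding C_def bd0 integral_mult_right[symmetric] by (simp add: mult.assoc)
    then show "C 1 0 0 = - (\<sigma> * f 0 * c 0)"
      using c[of 0] T by simp
    have "C 1 0 T = \<sigma> * f T * C 0 0 T"
      unfolding C_def bdT integral_mult_right[symmetric] by (simp add: mult.assoc)
    then show "C 1 0 T = \<sigma> * f T * c T"
      using c[of T] T by simp
  qed
qed

text \<open>
  The Wronskians of \<open>c\<close> with the solutions \<open>sinh (n (T - t))\<close> and \<open>sinh (n t)\<close> of the same
  equation are constant. Comparing their values at \<open>0\<close> and \<open>T\<close> expresses the boundary derivatives
  of \<open>c\<close> by its boundary values. For \<open>n = 0\<close> the function \<open>T - t\<close> takes the place of
  \<open>sinh (n (T - t))\<close>.
\<close>
lemma mode_boundary_derivatives: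
  fixes c c' :: "real \<Rightarrow> real" and n :: real
  assumes T: "T > 0"
    and c: "\<And>t. t \<in> {0..T} \<Longrightarrow> (c has_real_derivative c' t) (at t within {0..T})"
    and c': "\<And>t. t \<in> {0..T} \<Longrightarrow> (c' has_real_derivative n\<^sup>2 * c t) (at t within {0..T})"
  shows "c' 0 * sinh (n * T) = n * (c T - c 0 * cosh (n * T))"
    and "c' T * sinh (n * T) = n * (c T * cosh (n * T) - c 0)"
    and "n = 0 \<Longrightarrow> c' 0 * T = c T - c 0" and "n = 0 \<Longrightarrow> c' T = c' 0"
proof -
  have const: "W 0 = W T" if "\<And>t. t \<in> {0..T} \<Longrightarrow> (W has_real_derivative 0) (at t within {0..T})" for W
    using has_field_derivative_zero_constant[of "{0..T}" W] that T by force
  define W where "W t = c' t * sinh (n * (T - t)) + n * (c t * cosh (n * (T - t)))" for t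
  have "(W has_real_derivative 0) (at t within {0..T})" if "t \<in> {0..T}" for t
    unfolding W_def by (auto intro!: derivative_eq_intros c[OF that] c'[OF that] simp: algebra_simps power2_eq_square)
  from const[of W, OF this] show "c' 0 * sinh (n * T) = n * (c T - c 0 * cosh (n * T))"
    by (simp add: W_def algebra_simps)
  define V where "V t = c' t * sinh (n * t) - n * (c t * cosh (n * t))" for t
  have "(V has_real_derivative 0) (at t within {0..T})" if "t \<in> {0..T}" for t
    unfolding V_def by (auto intro!: derivative_eq_intros c[OF that] c'[OF that] simp: algebra_simps power2_eq_square)
  from const[of V, OF this] show "c' T * sinh (n * T) = n * (c T * cosh (n * T) - c 0)"
    by (simp add: V_def algebra_simps)
  assume n: "n = 0"
  have "((\<lambda>t. c' t * (T - t) + c t) has_real_derivative 0) (at t within {0..T})" if "t \<in> {0..T}" for t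
    using n by (auto intro!: derivative_eq_intros c[OF that] c'[OF that])
  from const[of "\<lambda>t. c' t * (T - t) + c t", OF this] show "c' 0 * T = c T - c 0"
    by simp
  from const[of c'] c' n show "c' T = c' 0"
    by simp
qed

section \<open>The first nonzero eigenvalue\<close>

text \<open>
  Subadditivity of \<open>tanh\<close> on the positive half-line, iterated.
\<close>
lemma tanh_mult_nat_le:
  fixes s :: real
  assumes "s \<ge> 0"
  shows "tanh (real n * s) \<le> real n * tanh s"
proof (induction n)
  case (Suc n)
  have "tanh (s + real n * s) = (tanh s + tanh (real n * s)) / (1 + tanh s * tanh (real n * s))"
    by (intro tanh_add) auto
  also have "\<dots> \<le> (tanh s + tanh (real n * s)) / 1"
    using assms by (intro divide_left_mono) (auto intro!: add_nonneg_nonneg mult_nonneg_nonneg add_pos_nonneg)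
  also have "\<dots> \<le> tanh s + real n * tanh s"
    using Suc by simp
  finally show ?case
    by (simp add: algebra_simps)
qed simp

text \<open>
  The left-hand side is the least energy \<open>\<integral> c'\<^sup>2 + c\<^sup>2\<close> over an interval of length \<open>2 S\<close> with
  boundary values \<open>x\<close> and \<open>y\<close>. It is diagonal in \<open>x + y\<close> and \<open>x - y\<close>, since the even and odd
  solutions \<open>cosh\<close> and \<open>sinh\<close> about the midpoint are orthogonal.
\<close>
lemma energy_form_half_angle:
  fixes S x y :: real
  assumes "S > 0"
  shows "(cosh (2 * S) * (x\<^sup>2 + y\<^sup>2) - 2 * x * y) / sinh (2 * S) =
    (coth S * (x - y)\<^sup>2 + tanh S * (x + y)\<^sup>2) / 2"
proof -
  have "sinh S > 0"
    using assms by simp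
  have "cosh (2 * S) * (x\<^sup>2 + y\<^sup>2) - 2 * x * y =
      ((cosh S)\<^sup>2 + (sinh S)\<^sup>2) * (x\<^sup>2 + y\<^sup>2) - ((cosh S)\<^sup>2 - (sinh S)\<^sup>2) * (2 * x * y)"
    by (simp add: cosh_double cosh_square_eq)
  also have "\<dots> = (cosh S)\<^sup>2 * (x - y)\<^sup>2 + (sinh S)\<^sup>2 * (x + y)\<^sup>2"
    by algebra
  finally show ?thesis
    unfolding sinh_double coth_def tanh_def using \<open>sinh S > 0\<close>
    by (simp add: field_simps power2_eq_square)
qed

text \<open>
  The right-hand side is the least energy \<open>\<integral> c'\<^sup>2 + n\<^sup>2 c\<^sup>2\<close> over \<open>[0,T]\<close>. In the diagonal form the
  claim is \<open>tanh S \<le> n tanh (n S)\<close> and \<open>coth S \<le> n coth (n S)\<close> for \<open>S = T / 2\<close>.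
\<close>
lemma energy_form_mono:
  fixes T x y :: real and n :: nat
  assumes T: "T > 0" and n: "n \<ge> 1"
  shows "(cosh T * (x\<^sup>2 + y\<^sup>2) - 2 * x * y) / sinh T \<le>
    n * ((cosh (n * T) * (x\<^sup>2 + y\<^sup>2) - 2 * x * y) / sinh (n * T))"
proof -
  define S where "S = T / 2"
  have S: "S > 0" "real n * S > 0" "S \<le> real n * S"
    using assms by (auto simp: S_def)
  have "tanh (real n * S) > 0"
    using S by simp
  moreover have "tanh S > 0"
    using S by simp
  ultimately have "1 / tanh S \<le> n * (1 / tanh (n * S))"
    using tanh_mult_nat_le[of S n] S(1) by (simp add: field_simps)
  then have c: "coth S \<le> n * coth (n * S)"
    by (simp add: coth_def tanh_def)
  have "1 * tanh S \<le> n * tanh (n * S)"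
    using S n by (intro mult_mono) auto
  then have t: "tanh S \<le> n * tanh (n * S)"
    by simp
  have "coth S * (x - y)\<^sup>2 + tanh S * (x + y)\<^sup>2 \<le>
      n * coth (n * S) * (x - y)\<^sup>2 + n * tanh (n * S) * (x + y)\<^sup>2"
    by (intro add_mono mult_right_mono c t) auto
  moreover have "(cosh T * (x\<^sup>2 + y\<^sup>2) - 2 * x * y) / sinh T =
      (coth S * (x - y)\<^sup>2 + tanh S * (x + y)\<^sup>2) / 2"
    using energy_form_half_angle[OF S(1), of x y] by (simp add: S_def)
  moreover have "(cosh (n * T) * (x\<^sup>2 + y\<^sup>2) - 2 * x * y) / sinh (n * T) =
      (coth (n * S) * (x - y)\<^sup>2 + tanh (n * S) * (x + y)\<^sup>2) / 2"
    using energy_form_half_angle[OF S(2), of x y] by (simp add: S_def)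
  ultimately show ?thesis
    by (simp only: distrib_left times_divide_eq_right mult.assoc divide_right_mono zero_le_numeral)
qed

text \<open>
  The difference is a quadratic form \<open>A x\<^sup>2 + B y\<^sup>2 - 2 r x y\<close> with \<open>A > 0\<close>. Its determinant
  \<open>A B - r\<^sup>2\<close> is the quadratic polynomial with root \<open>lambda11\<close>, so it vanishes and the form is a
  square up to the factor \<open>A\<close>.
\<close>
lemma lambda11_le_energy_form:
  fixes x y :: real
  assumes pos: "f 0 > 0" "f T > 0" "T > 0"
  shows "lambda11 T f * (f 0 * x\<^sup>2 + f T * y\<^sup>2) \<le> (cosh T * (x\<^sup>2 + y\<^sup>2) - 2 * x * y) / sinh T"
proof -
  define r where "r = 1 / sinh T"
  define A where "A = coth T - lambda11 T f * f 0"
  define B where "B = coth T - lambda11 T f * f T"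
  have A: "A > 0"
    using lambda11_less_coth[of f, OF pos] by (simp add: A_def)
  have "(coth T)\<^sup>2 - 1 = r\<^sup>2"
    using pos(3) by (simp add: coth_def r_def field_simps cosh_square_eq)
  moreover have "A * B = (coth T)\<^sup>2 - 1"
    using lambda11_root[of f, OF pos] unfolding A_def B_def by algebra
  ultimately have "A * (A * x\<^sup>2 + B * y\<^sup>2 - 2 * r * x * y) = (A * x - r * y)\<^sup>2"
    by algebra
  then have "0 \<le> A * x\<^sup>2 + B * y\<^sup>2 - 2 * r * x * y"
    using A by (metis zero_le_mult_iff zero_le_power2 not_le)
  also have "\<dots> = (cosh T * (x\<^sup>2 + y\<^sup>2) - 2 * x * y) / sinh T - lambda11 T f * (f 0 * x\<^sup>2 + f T * y\<^sup>2)"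
    unfolding A_def B_def r_def coth_def using pos(3) by (simp add: field_simps)
  finally show ?thesis by simp
qed

lemma rot_sym_metricD:
  assumes "rot_sym_metric T f"
  shows "T > 0" "f 0 > 0" "f T > 0" "\<And>t. t \<in> {0..T} \<Longrightarrow> f t > 0"
  using assms by (auto simp: rot_sym_metric_def)

text \<open>
  By completeness some Fourier coefficient of an eigenfunction is nonzero at a boundary point.
  If its frequency is \<open>0\<close>, the coefficient is affine and the boundary conditions force
  \<open>\<sigma> = lambda02\<close>, as \<open>\<sigma>\<close> is nonzero. If its frequency is \<open>n \<ge> 1\<close>, the boundary conditions identify
  \<open>\<sigma> (f 0 x\<^sup>2 + f T y\<^sup>2)\<close> with the energy of the coefficient, which is at least that of frequency \<open>1\<close>
  with the same boundary values \<open>x\<close> and \<open>y\<close>.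
\<close>
lemma dtn_eigenvalue_lower_bound:
  assumes m: "rot_sym_metric T f" and "dtn_eigenvalue T f \<sigma>" and \<sigma>: "\<sigma> \<noteq> 0"
  shows "\<sigma> = lambda02 T f \<or> lambda11 T f \<le> \<sigma>"
proof -
  note pos = rot_sym_metricD[OF m]
  obtain u v p where p: "p \<in> strip_boundary T" "u p \<noteq> 0" and v: "harmonic_extension T f u v"
    and bd: "\<And>p. p \<in> strip_boundary T \<Longrightarrow> \<sigma> * u p = conormal_derivative T f v p"
    using assms(2) unfolding dtn_eigenvalue_def dirichlet_to_neumann_def by blast
  obtain \<tau> b where \<tau>: "p = (\<tau>, b)" "\<tau> = 0 \<or> \<tau> = T"
    using p(1) by (auto simp: strip_boundary_def)
  have "v (\<tau>, b) \<noteq> 0"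
    using p v \<tau> by (auto simp: harmonic_extension_def)
  have "\<tau> \<in> {0..T}"
    using \<tau> pos by auto
  define c where "c k \<phi> t = integral {b..b + 2 * pi} (\<lambda>\<theta>. v (t, \<theta>) * cos (of_int k * \<theta> - \<phi>))"
    for k :: int and \<phi> t :: real
  \<comment> \<open>The period \<open>[b, b + 2\<pi>]\<close> starts at the angle where the eigenfunction is known to be nonzero.\<close>
  have "\<exists>k \<phi>. c k \<phi> \<tau> \<noteq> 0"
  proof (rule ccontr)
    assume "\<not> (\<exists>k \<phi>. c k \<phi> \<tau> \<noteq> 0)"
    then have zero: "c k \<phi> \<tau> = 0" for k \<phi>
      by blast
    obtain D where D: "cylinder_derivatives T v D" and per: "v (\<tau>, b + 2 * pi) = v (\<tau>, b)"
      using v \<open>\<tau> \<in> {0..T}\<close> unfolding harmonic_extension_def smooth_on_cylinder_iff by blast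
    have "continuous_on {b..b + 2 * pi} (\<lambda>\<theta>. D 0 0 (\<tau>, \<theta>))"
      using cylinder_derivatives_theta[OF pos(1) D \<open>\<tau> \<in> {0..T}\<close>, of 0 0]
      by (intro DERIV_continuous_on) (rule has_field_derivative_at_within)
    then have cont: "continuous_on {b..b + 2 * pi} (\<lambda>\<theta>. v (\<tau>, \<theta>))"
      using cylinder_derivatives_0[OF pos(1) D \<open>\<tau> \<in> {0..T}\<close>] by simp
    have "((\<lambda>\<theta>. v (\<tau>, \<theta>) * cos (of_int k * \<theta> - \<phi>)) has_integral c k \<phi> \<tau>) {b..b + 2 * pi}"
      for k :: int and \<phi>
      unfolding c_def
      by (intro integrable_integral integrable_continuous_real continuous_intros cont)
    then have "trig_orthogonal b (\<lambda>\<theta>. v (\<tau>, \<theta>))"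
      using cont unfolding zero trig_orthogonal_def by blast
    from trig_orthogonal_imp_zero[OF this per, of b] \<open>v (\<tau>, b) \<noteq> 0\<close> show False
      by simp
  qed
  then obtain k \<phi> where nz: "c k \<phi> \<tau> \<noteq> 0"
    by blast
  obtain c' where
    c: "\<And>t. t \<in> {0..T} \<Longrightarrow> (c k \<phi> has_real_derivative c' t) (at t within {0..T})"
    and c': "\<And>t. t \<in> {0..T} \<Longrightarrow> (c' has_real_derivative (of_int k)\<^sup>2 * c k \<phi> t) (at t within {0..T})"
    and c0: "c' 0 = - (\<sigma> * f 0 * c k \<phi> 0)" and cT: "c' T = \<sigma> * f T * c k \<phi> T"
    using eigenfunction_mode[OF pos(1,4) v bd, where k = k and b = b and \<phi> = \<phi>] unfolding c_def by blast
  define n where "n = nat \<bar>k\<bar>"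
  have kn: "(of_int k)\<^sup>2 = (real n)\<^sup>2"
    by (simp add: n_def)
  note bdry = mode_boundary_derivatives[OF pos(1) c c'[unfolded kn]]
  define x y where "x = c k \<phi> 0" and "y = c k \<phi> T"
  have xy: "x \<noteq> 0 \<or> y \<noteq> 0"
    using nz \<tau> by (auto simp: x_def y_def)
  show ?thesis
  proof (cases "n = 0")
    case True
    with bdry(3,4) have 1: "- (\<sigma> * f 0 * x * T) = y - x" and 2: "\<sigma> * f T * y = - (\<sigma> * f 0 * x)"
      unfolding c0 cT x_def y_def by simp_all
    from 2 \<sigma> have 3: "f T * y = - (f 0 * x)"
      by (metis mult.assoc mult_cancel_left mult_minus_right)
    then have "x \<noteq> 0"
      using xy pos(3) by auto
    have "x * (\<sigma> * (f 0 * f T * T)) = x * (f 0 + f T)"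
      using 1 3 by algebra
    then have "\<sigma> * (f 0 * f T * T) = f 0 + f T"
      using \<open>x \<noteq> 0\<close> by simp
    then show ?thesis
      using pos(1-3) by (simp add: lambda02_def field_simps)
  next
    case False
    then have n: "n \<ge> 1" and sinh: "sinh (real n * T) > 0"
      using pos by auto
    have "\<sigma> * (f 0 * x\<^sup>2 + f T * y\<^sup>2) * sinh (real n * T) =
        n * (cosh (real n * T) * (x\<^sup>2 + y\<^sup>2) - 2 * x * y)"
      using bdry(1,2) unfolding c0 cT x_def[symmetric] y_def[symmetric] by algebra
    then have e: "\<sigma> * (f 0 * x\<^sup>2 + f T * y\<^sup>2) =
        n * ((cosh (real n * T) * (x\<^sup>2 + y\<^sup>2) - 2 * x * y) / sinh (real n * T))"
      unfolding times_divide_eq_right nonzero_eq_divide_eq[OF less_imp_neq[OF sinh, symmetric]] .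
    have "lambda11 T f * (f 0 * x\<^sup>2 + f T * y\<^sup>2) \<le> \<sigma> * (f 0 * x\<^sup>2 + f T * y\<^sup>2)"
      unfolding e using lambda11_le_energy_form[of f, OF pos(2,3,1)] energy_form_mono[OF pos(1) n]
      by (rule order_trans)
    moreover have "f 0 * x\<^sup>2 + f T * y\<^sup>2 > 0"
      using xy pos(2,3) by (auto intro: add_pos_nonneg add_nonneg_pos)
    ultimately show ?thesis
      by simp
  qed
qed

text \<open>
  Both \<open>lambda02\<close> and \<open>lambda11\<close> are realized by products. Giving the factors as sequences of
  successive derivatives supplies all the partial derivatives that smoothness asks for.
\<close>
lemma dtn_eigenvalue_separated:
  fixes F G :: "nat \<Rightarrow> real \<Rightarrow> real"
  assumes T: "T > 0" and f: "f 0 > 0" "f T > 0"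
    and F: "\<And>i t. (F i has_real_derivative F (Suc i) t) (at t)"
    and G: "\<And>j \<theta>. (G j has_real_derivative G (Suc j) \<theta>) (at \<theta>)"
    and per: "\<And>\<theta>. G 0 (\<theta> + 2 * pi) = G 0 \<theta>"
    and harm: "\<And>t \<theta>. F 2 t * G 0 \<theta> + F 0 t * G 2 \<theta> = 0"
    and bd: "F 1 0 = - (\<sigma> * f 0 * F 0 0)" "F 1 T = \<sigma> * f T * F 0 T"
    and nz: "F 0 0 * G 0 0 \<noteq> 0"
  shows "dtn_eigenvalue T f \<sigma>"
proof -
  define v where "v p = F 0 (fst p) * G 0 (snd p)" for p
  define D where "D i j p = F i (fst p) * G j (snd p)" for i j p
  have contF: "continuous_on UNIV (F i)" and contG: "continuous_on UNIV (G i)" for i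
    using F G by (blast intro: DERIV_continuous_on)+
  have D: "cylinder_derivatives T v D"
    unfolding cylinder_derivatives_def
  proof (intro conjI allI ballI)
    show "continuous_on (strip T) (D i j)" for i j
      unfolding D_def
      by (intro continuous_intros continuous_on_compose2[OF contF] continuous_on_compose2[OF contG]) auto
    show "((\<lambda>s. D i j (s, \<theta>)) has_real_derivative D (Suc i) j (t, \<theta>)) (at t within {0..T})" for i j t \<theta>
      unfolding D_def using DERIV_cmult_right[OF F[of i t], of "G j \<theta>"]
      by (auto intro: has_field_derivative_at_within)
    show "((\<lambda>s. D i j (t, s)) has_real_derivative D i (Suc j) (t, \<theta>)) (at \<theta>)" for i j t \<theta>
      unfolding D_def using DERIV_cmult[OF G[of j \<theta>], of "F i t"] by simp
  qed (simp add: D_def v_def)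
  have "harmonic_extension T f v v"
    unfolding harmonic_extension_def smooth_on_cylinder_iff
    using D laplacian_cylinder[OF T D] harm by (auto simp: strip_def v_def D_def per)
  moreover have "\<sigma> * v p = conormal_derivative T f v p" if "p \<in> strip_boundary T" for p
    using that partial_t_cylinder[OF T D, of 0] partial_t_cylinder[OF T D, of T] T f bd
    by (auto simp: strip_boundary_def conormal_derivative_def D_def v_def field_simps)
  moreover have "(0, 0) \<in> strip_boundary T" "v (0, 0) \<noteq> 0"
    using nz by (auto simp: strip_boundary_def v_def)
  ultimately show ?thesis
    unfolding dtn_eigenvalue_def dirichlet_to_neumann_def by blast
qed

lemma dtn_eigenvalue_lambda02:
  assumes "rot_sym_metric T f"
  shows "dtn_eigenvalue T f (lambda02 T f)"
proof -
  note pos = rot_sym_metricD[OF assms]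
  \<comment> \<open>The slope is dictated by the boundary condition at \<open>t = 0\<close>.\<close>
  define m where "m = lambda02 T f * f 0"
  define F :: "nat \<Rightarrow> real \<Rightarrow> real"
    where "F i t = (if i = 0 then 1 - m * t else if i = 1 then - m else 0)" for i t
  define G :: "nat \<Rightarrow> real \<Rightarrow> real" where "G j \<theta> = (if j = 0 then 1 else 0)" for j \<theta>
  show ?thesis
  proof (rule dtn_eigenvalue_separated[where F = F and G = G])
    show "(F i has_real_derivative F (Suc i) t) (at t)" for i t
      unfolding F_def[abs_def] by (auto intro!: derivative_eq_intros)
    show "(G j has_real_derivative G (Suc j) \<theta>) (at \<theta>)" for j \<theta>
      unfolding G_def[abs_def] by (auto intro!: derivative_eq_intros)
    have "lambda02 T f * (f 0 * f T * T) = f 0 + f T"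
      using pos(1-3) by (simp add: lambda02_def)
    then have "- m = lambda02 T f * f T * (1 - m * T)"
      unfolding m_def by algebra
    then show "F 1 T = lambda02 T f * f T * F 0 T"
      by (simp add: F_def)
  qed (use pos in \<open>auto simp: F_def G_def m_def\<close>)
qed

lemma dtn_eigenvalue_lambda11:
  assumes "rot_sym_metric T f"
  shows "dtn_eigenvalue T f (lambda11 T f)"
proof -
  note pos = rot_sym_metricD[OF assms]
  \<comment> \<open>Again \<open>m\<close> is dictated by the boundary condition at \<open>t = 0\<close>; the condition at \<open>t = T\<close> is the
    quadratic equation for \<open>lambda11\<close>. The phase \<open>j \<pi> / 2\<close> differentiates the cosine \<open>j\<close> times.\<close>
  define m where "m = lambda11 T f * f 0"
  define F :: "nat \<Rightarrow> real \<Rightarrow> real"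
    where "F i t = (if even i then cosh t - m * sinh t else sinh t - m * cosh t)" for i t
  define G :: "nat \<Rightarrow> real \<Rightarrow> real" where "G j \<theta> = cos (\<theta> + of_nat j * (pi / 2))" for j \<theta>
  show ?thesis
  proof (rule dtn_eigenvalue_separated[where F = F and G = G])
    show "(F i has_real_derivative F (Suc i) t) (at t)" for i t
      unfolding F_def[abs_def] by (cases "even i") (auto intro!: derivative_eq_intros)
    show "(G j has_real_derivative G (Suc j) \<theta>) (at \<theta>)" for j \<theta>
    proof -
      have "\<theta> + of_nat (Suc j) * (pi / 2) = (\<theta> + of_nat j * (pi / 2)) + pi / 2"
        by (simp add: field_simps)
      then have "G (Suc j) \<theta> = - sin (\<theta> + of_nat j * (pi / 2))"
        unfolding G_def by (simp only: cos_add) simp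
      then show ?thesis
        unfolding G_def[of j, abs_def] by (auto intro!: derivative_eq_intros)
    qed
    show "F 2 t * G 0 \<theta> + F 0 t * G 2 \<theta> = 0" for t \<theta>
      by (simp add: F_def G_def)
    have "(cosh T - m * sinh T) * (lambda11 T f * f T) = sinh T - m * cosh T"
    proof -
      have "coth T * sinh T = cosh T"
        using pos(1) by (simp add: coth_def)
      then have "sinh T - m * cosh T - (cosh T - m * sinh T) * (lambda11 T f * f T) =
          sinh T * (f 0 * f T * (lambda11 T f)\<^sup>2 - (f 0 + f T) * coth T * lambda11 T f + 1)"
        unfolding m_def by (simp add: algebra_simps power2_eq_square flip: \<open>coth T * sinh T = cosh T\<close>)
      then show ?thesis
        unfolding lambda11_root[of f, OF pos(2,3,1)] by simp
    qed
    then show "F 1 T = lambda11 T f * f T * F 0 T"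
      by (simp add: F_def mult_ac)
  qed (use pos in \<open>auto simp: F_def G_def m_def\<close>)
qed

lemma sigma1_eq_min:
  assumes "rot_sym_metric T f"
  shows "sigma1 T f = min (lambda02 T f) (lambda11 T f)"
  unfolding sigma1_def
proof (rule Least_equality)
  note pos = rot_sym_metricD[OF assms]
  have "lambda02 T f > 0"
    using pos(1-3) by (simp add: lambda02_def)
  moreover have "lambda11 T f > 0"
    using lambda11_pos[of f, OF pos(2,3,1)] .
  ultimately show "dtn_eigenvalue T f (min (lambda02 T f) (lambda11 T f)) \<and> min (lambda02 T f) (lambda11 T f) \<noteq> 0"
    using dtn_eigenvalue_lambda02[OF assms] dtn_eigenvalue_lambda11[OF assms] by (simp add: min_def)
  show "min (lambda02 T f) (lambda11 T f) \<le> \<sigma>" if "dtn_eigenvalue T f \<sigma> \<and> \<sigma> \<noteq> 0" for \<sigma>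
    using dtn_eigenvalue_lower_bound[OF assms, of \<sigma>] that by auto
qed

section \<open>The transition value and the maximum\<close>

text \<open>
  The number \<open>l = 1 / (t2 a * f 0) = 1 / (t1 a * f T)\<close> separates the two eigenvalues: at
  \<open>T = t1 a + t2 a\<close> both are equal to \<open>l\<close>, and on either side of this value of \<open>T\<close> one of them exceeds
  \<open>l\<close> and the other falls below it. For \<open>lambda02\<close>, which is \<open>l (t1 a + t2 a) / T\<close>, this is
  immediate; for \<open>lambda11\<close> it is the comparison by the addition formula, with
  \<open>l * f 0 = tanh (t2 a - a)\<close> and \<open>l * f T = tanh (t1 a + a)\<close>.
\<close>
lemma eigenvalue_comparison:
  assumes m: "rot_sym_metric T f" and a: "boundary_ratio T f = alpha a"
  obtains l where
    "l \<le> lambda02 T f \<longleftrightarrow> T \<le> t1 a + t2 a" "lambda02 T f \<le> l \<longleftrightarrow> t1 a + t2 a \<le> T"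
    "l \<le> lambda11 T f \<longleftrightarrow> t1 a + t2 a \<le> T" "lambda11 T f \<le> l \<longleftrightarrow> T \<le> t1 a + t2 a"
    "l * boundary_length T f = 2 * pi * (inverse (t1 a) + inverse (t2 a))"
proof
  note pos = rot_sym_metricD[OF m]
  note t = t1_pos[of a] t2_pos[of a]
  define l where "l = 1 / (t2 a * f 0)"
  have eq: "t2 a * f 0 = t1 a * f T"
    using a pos(1-3) t by (simp add: boundary_ratio_def alpha_def field_simps)
  have l0: "l * f 0 = inverse (t2 a)"
    using pos(1-3) t by (simp add: l_def field_simps)
  have lT: "l * f T = inverse (t1 a)"
    unfolding l_def eq using pos(1-3) t by (simp add: field_simps)
  have "l > 0"
    using pos(1-3) t by (simp add: l_def)
  have "lambda02 T f = (1 / f 0 + 1 / f T) / T"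
    using pos(1-3) by (simp add: lambda02_def field_simps)
  also have "1 / f 0 = l * t2 a"
    using l0 pos(1-3) t by (simp add: field_simps)
  also have "1 / f T = l * t1 a"
    using lT pos(1-3) t by (simp add: field_simps)
  finally have l02: "lambda02 T f = l * ((t1 a + t2 a) / T)"
    by (simp add: algebra_simps)
  show "l \<le> lambda02 T f \<longleftrightarrow> T \<le> t1 a + t2 a" "lambda02 T f \<le> l \<longleftrightarrow> t1 a + t2 a \<le> T"
    using mult_le_cancel_left_pos[OF \<open>l > 0\<close>, of 1 "(t1 a + t2 a) / T"]
      mult_le_cancel_left_pos[OF \<open>l > 0\<close>, of "(t1 a + t2 a) / T" 1] pos(1)
    unfolding l02 by (simp_all add: le_divide_eq divide_le_eq)
  show "l \<le> lambda11 T f \<longleftrightarrow> t1 a + t2 a \<le> T" "lambda11 T f \<le> l \<longleftrightarrow> T \<le> t1 a + t2 a"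
    using lambda11_compare[of f, OF pos(2,3,1) t1_add_pos t2_diff_pos,
        OF l0[unfolded inverse_t2] lT[unfolded inverse_t1]]
    by simp_all
  have "l * boundary_length T f = 2 * pi * (l * f 0 + l * f T)"
    by (simp add: boundary_length_def algebra_simps)
  then show "l * boundary_length T f = 2 * pi * (inverse (t1 a) + inverse (t2 a))"
    unfolding l0 lT by (simp add: add.commute)
qed

lemma sigma1_transition:
  assumes m: "rot_sym_metric T f" and a: "boundary_ratio T f = alpha a"
  shows "T \<le> t1 a + t2 a \<Longrightarrow> sigma1 T f = lambda11 T f"
    and "t1 a + t2 a \<le> T \<Longrightarrow> sigma1 T f = lambda02 T f"
    and "lambda02 T f = lambda11 T f \<longleftrightarrow> T = t1 a + t2 a"
  using sigma1_eq_min[OF m] eigenvalue_comparison[OF m a] by (smt (verit))+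

lemma sigma1_L_upper_bound:
  assumes m: "rot_sym_metric T f" and a: "boundary_ratio T f = alpha a"
  shows "sigma1_L T f \<le> 2 * pi * (inverse (t1 a) + inverse (t2 a))"
    and "sigma1_L T f = 2 * pi * (inverse (t1 a) + inverse (t2 a)) \<longleftrightarrow> T = t1 a + t2 a"
proof -
  obtain l where l: "sigma1 T f \<le> l" "sigma1 T f = l \<longleftrightarrow> T = t1 a + t2 a"
    and L: "l * boundary_length T f = 2 * pi * (inverse (t1 a) + inverse (t2 a))"
    using sigma1_eq_min[OF m] eigenvalue_comparison[OF m a] by (smt (verit))
  have "boundary_length T f > 0"
    using rot_sym_metricD[OF m] by (simp add: boundary_length_def add_pos_pos)
  with l show "sigma1_L T f \<le> 2 * pi * (inverse (t1 a) + inverse (t2 a))"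
    "sigma1_L T f = 2 * pi * (inverse (t1 a) + inverse (t2 a)) \<longleftrightarrow> T = t1 a + t2 a"
    unfolding sigma1_L_def L[symmetric] by simp_all
qed

lemma rot_sym_metric_exists:
  assumes "T > 0" "r > 0"
  obtains f where "rot_sym_metric T f" "boundary_ratio T f = r"
proof
  define f where "f t = r * (1 - t / T) + t / T" for t
  define F where "F n t = (if n = 0 then f t else if n = 1 then (1 - r) / T else 0)" for n :: nat and t
  have "smooth_on_interval T f"
    unfolding smooth_on_interval_def
  proof (intro exI[of _ F] conjI allI ballI)
    show "(F n has_real_derivative F (Suc n) t) (at t within {0..T})" for n t
      unfolding F_def[abs_def] f_def using assms(1)
      by (auto intro!: derivative_eq_intros simp: field_simps)
  qed (simp add: F_def)
  moreover have "f t > 0" if "t \<in> {0..T}" for t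
  proof (cases "t = T")
    case False
    then have "r * (1 - t / T) > 0"
      using that assms by simp
    then show ?thesis
      using that assms by (simp add: f_def add_pos_nonneg)
  qed (use assms in \<open>simp add: f_def\<close>)
  ultimately show "rot_sym_metric T f"
    using assms by (simp add: rot_sym_metric_def)
  show "boundary_ratio T f = r"
    using assms by (simp add: boundary_ratio_def f_def)
qed

text \<open>
  At a transition value both descriptions of \<open>sigma1\<close> apply, so \<open>lambda02 = lambda11\<close> there, and
  this happens for one \<open>T\<close> only.
\<close>
lemma is_transition_alpha_iff: "is_transition (alpha a) T0 \<longleftrightarrow> T0 = t1 a + t2 a"
proof
  assume tr: "is_transition (alpha a) T0"
  show "T0 = t1 a + t2 a"
  proof (rule ccontr)
    assume ne: "T0 \<noteq> t1 a + t2 a"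
    have "T0 > 0"
      using tr by (simp add: is_transition_def)
    then obtain f where f: "rot_sym_metric T0 f" "boundary_ratio T0 f = alpha a"
      using rot_sym_metric_exists alpha_pos by metis
    then have "lambda02 T0 f = lambda11 T0 f"
      using tr unfolding is_transition_def by (metis order_refl)
    then show False
      using sigma1_transition(3)[OF f] ne by simp
  qed
next
  assume T0: "T0 = t1 a + t2 a"
  then show "is_transition (alpha a) T0"
    using sigma1_transition t1_pos t2_pos by (simp add: is_transition_def add_pos_pos)
qed

lemma T_of_alpha: "T_of (alpha a) = t1 a + t2 a"
  by (simp add: T_of_def is_transition_alpha_iff)

lemma obtain_alpha:
  assumes "r > 0"
  obtains a where "r = alpha a"
  using range_alpha assms by (metis greaterThan_iff imageE)

lemma is_maximum_alpha:
  "is_maximum {sigma1_L T f | T f. rot_sym_metric T f \<and> boundary_ratio T f = alpha a}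
     (2 * pi * (inverse (t1 a) + inverse (t2 a)))"
proof -
  obtain f where "rot_sym_metric (t1 a + t2 a) f" "boundary_ratio (t1 a + t2 a) f = alpha a"
    using rot_sym_metric_exists[of "t1 a + t2 a" "alpha a"] alpha_pos t1_pos t2_pos by (metis add_pos_pos)
  then have "2 * pi * (inverse (t1 a) + inverse (t2 a)) \<in>
      {sigma1_L T f | T f. rot_sym_metric T f \<and> boundary_ratio T f = alpha a}"
    using sigma1_L_upper_bound(2) by (smt (verit) mem_Collect_eq)
  then show ?thesis
    using sigma1_L_upper_bound(1) by (auto simp: is_maximum_def)
qed

lemma sigma1_L_le:
  assumes "rot_sym_metric T f"
  shows "sigma1_L T f \<le> 4 * pi / t1 0"
    and "sigma1_L T f = 4 * pi / t1 0 \<longleftrightarrow> boundary_ratio T f = 1 \<and> T = 2 * t1 0"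
proof -
  have "boundary_ratio T f > 0"
    using rot_sym_metricD[OF assms] by (simp add: boundary_ratio_def)
  then obtain a where a: "boundary_ratio T f = alpha a"
    using obtain_alpha by metis
  note bound = sigma1_L_upper_bound[OF assms a]
  show "sigma1_L T f \<le> 4 * pi / t1 0"
    "sigma1_L T f = 4 * pi / t1 0 \<longleftrightarrow> boundary_ratio T f = 1 \<and> T = 2 * t1 0"
  proof (atomize (full), cases "a = 0")
    case True
    then show "sigma1_L T f \<le> 4 * pi / t1 0 \<and>
      (sigma1_L T f = 4 * pi / t1 0) = (boundary_ratio T f = 1 \<and> T = 2 * t1 0)"
      using bound a alpha_0 by (simp add: t2_eq_t1 field_simps)
  next
    case False
    then have "2 * pi * (inverse (t1 a) + inverse (t2 a)) < 2 * pi * (2 / t1 0)"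
      by (intro mult_strict_left_mono inverse_t1_add_inverse_t2_less) auto
    then have "sigma1_L T f < 4 * pi / t1 0"
      using bound(1) by simp
    moreover have "boundary_ratio T f \<noteq> 1"
      using False a alpha_eq_iff[of a 0] alpha_0 by simp
    ultimately show "sigma1_L T f \<le> 4 * pi / t1 0 \<and>
      (sigma1_L T f = 4 * pi / t1 0) = (boundary_ratio T f = 1 \<and> T = 2 * t1 0)"
      by simp
  qed
qed

theorem theorem3p1:
  shows
    "(\<forall>a. (\<exists>!t. t > 0 \<and> t = coth (t + a)) \<and> (\<exists>!t. t > 0 \<and> t = coth (t - a))) \<and>
     (\<forall>\<alpha>>0. \<exists>!T0. is_transition \<alpha> T0) \<and>

     (strict_antimono_on UNIV alpha \<and> range alpha = {0<..}) \<and>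

     (\<forall>a. T_of (alpha a) = t1 a + t2 a \<and>
          is_maximum {sigma1_L T f | T f. rot_sym_metric T f \<and> boundary_ratio T f = alpha a}
            (2 * pi * (inverse (t1 a) + inverse (t2 a)))) \<and>

     (is_maximum {sigma1_L T f | T f. rot_sym_metric T f} (4 * pi / t1 0) \<and>
      (\<forall>a. (\<exists>T f. rot_sym_metric T f \<and> boundary_ratio T f = alpha a \<and>
                   sigma1_L T f = 4 * pi / t1 0) \<longleftrightarrow> a = 0) \<and>
      alpha 0 = 1 \<and>
      (\<forall>T f. rot_sym_metric T f \<longrightarrow>
         (sigma1_L T f = 4 * pi / t1 0 \<longleftrightarrow> boundary_ratio T f = 1 \<and> T = T_of 1)) \<and>
      T_of 1 = 2 * t1 0 \<and>
      t1 0 > 0 \<and> t1 0 = coth (t1 0) \<and>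
      \<bar>t1 0 - 1.2\<bar> < 0.05)"
proof (intro conjI allI impI)
  fix a :: real
  show "\<exists>!t. t > 0 \<and> t = coth (t + a)"
    by (rule ex1_fixpoint_coth)
  show "\<exists>!t. t > 0 \<and> t = coth (t - a)"
    using ex1_fixpoint_coth[of "- a"] by simp
  show "T_of (alpha a) = t1 a + t2 a"
    by (rule T_of_alpha)
  show "is_maximum {sigma1_L T f | T f. rot_sym_metric T f \<and> boundary_ratio T f = alpha a}
      (2 * pi * (inverse (t1 a) + inverse (t2 a)))"
    by (rule is_maximum_alpha)
  have "boundary_ratio T f = alpha a \<Longrightarrow> boundary_ratio T f = 1 \<longleftrightarrow> a = 0" for T f
    using alpha_eq_iff[of a 0] alpha_0 by simp
  moreover obtain f where "rot_sym_metric (2 * t1 0) f" "boundary_ratio (2 * t1 0) f = alpha 0"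
    using rot_sym_metric_exists[of "2 * t1 0" "alpha 0"] t1_pos[of 0] alpha_pos[of 0] by auto
  ultimately show "(\<exists>T f. rot_sym_metric T f \<and> boundary_ratio T f = alpha a \<and>
      sigma1_L T f = 4 * pi / t1 0) \<longleftrightarrow> a = 0"
    using sigma1_L_le(2) alpha_0 by metis
next
  fix r :: real
  assume "r > 0"
  then obtain a where "r = alpha a"
    using obtain_alpha by blast
  then show "\<exists>!T0. is_transition r T0"
    by (simp add: is_transition_alpha_iff)
next
  show T1: "T_of 1 = 2 * t1 0"
    using T_of_alpha[of 0] by (simp add: alpha_0 t2_eq_t1)
  show "sigma1_L T f = 4 * pi / t1 0 \<longleftrightarrow> boundary_ratio T f = 1 \<and> T = T_of 1"
    if "rot_sym_metric T f" for T f
    unfolding T1 by (rule sigma1_L_le(2)[OF that])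
  obtain f where "rot_sym_metric (2 * t1 0) f" "boundary_ratio (2 * t1 0) f = 1"
    using rot_sym_metric_exists[of "2 * t1 0" 1] t1_pos[of 0] by auto
  then have "4 * pi / t1 0 \<in> {sigma1_L T f | T f. rot_sym_metric T f}"
    using sigma1_L_le(2) by (smt (verit) mem_Collect_eq)
  then show "is_maximum {sigma1_L T f | T f. rot_sym_metric T f} (4 * pi / t1 0)"
    using sigma1_L_le(1) by (auto simp: is_maximum_def)
  show "t1 0 = coth (t1 0)"
    using t1_eq[of 0] by simp
  show "\<bar>t1 0 - 1.2\<bar> < 0.05"
    unfolding abs_diff_less_iff using t1_0_gt t1_0_less by simp
qed (simp_all add: alpha_strict_antimono range_alpha alpha_0 t1_pos)

end
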